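(* Let $n\in\mathbb N$ and $\sigma^0\in\mathbb R^N$. There exists a unique real-analytic classical solution $(0,+\infty)\ni t\mapsto\sigma(t)\in\mathbb R^N$ of the Cauchy problem $$\frac{d}{dt}\sigma=-\nabla F_n(\sigma)\quad\forall t>0,\qquad\sigma(0)=\sigma^0.$$
   Context: Let $\Omega=(0,1)^d$ and let $f\in L^\infty(\Omega)$ satisfy $\int_\Omega f\,dx=0$ and $\operatorname{conv}(\operatorname{supp} f)\subset\subset\Omega$. $(\mathcal T^n)_{n\in\mathbb N}$ is a sequence of nested simplicial triangulations of $\Omega$ obtained by successive uniform refinements, $\mathcal T^n=\{T^n_1,\dots,T^n_N\}$ ($N$ depends on $n$). $\mathcal W_n$ is the space of continuous functions on $\Omega$, affine on each simplex of $\mathcal T^{n+1}$, with zero integral over $\Omega$; $\phi_1,\dots,\phi_M$ is a basis of it. $(\delta_n)$ is a monotone sequence of positive reals with $\delta_n\downarrow0$. Put $A^{(i)}=\left(\int_{T_i^n}\nabla\phi_p\cdot\nabla\phi_q\,dx\right)_{p,q}$, $A(\mu)=\sum_{i=1}^N(\mu_i+\delta_n)A^{(i)}$, $\boldsymbol f=\left(\int_\Omega f\phi_p\,dx\right)_p$, $a=(|T_1^n|,\dots,|T_N^n|)$, and $E_n(\mu)=\boldsymbol f^{\,t}A(\mu)^{-1}\boldsymbol f+\langle\mu,a\rangle$ for $\mu\in\mathbb R^N_{\ge0}$. For $\sigma\in\mathbb R^N$, $F_n(\sigma):=E_n(\sigma_1^2,\dots,\sigma_N^2)$. *)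

theory Defs
  imports "HOL-Analysis.Analysis"
begin

definition unit_cube :: "(real ^ 'd) set" where
  "unit_cube = {x. \<forall>i. 0 < x $ i \<and> x $ i < 1}"

definition compactly_contained :: "'a::topological_space set \<Rightarrow> 'a set \<Rightarrow> bool"
    (infix "\<subset>\<subset>" 50) where
  "A \<subset>\<subset> B \<longleftrightarrow> compact (closure A) \<and> closure A \<subseteq> B"

definition L_infinity_on :: "(real ^ 'd) set \<Rightarrow> (real ^ 'd \<Rightarrow> real) \<Rightarrow> bool" where
  "L_infinity_on \<Omega> f \<longleftrightarrow>
     f \<in> borel_measurable (lebesgue_on \<Omega>) \<and> (\<exists>C. AE x in lebesgue_on \<Omega>. \<bar>f x\<bar> \<le> C)"

text \<open>The support of a class of functions modulo null sets: the complement of the largest open set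
  on which \<open>f\<close>, restricted to \<open>\<Omega>\<close>, vanishes almost everywhere.\<close>

definition ess_support_on :: "(real ^ 'd) set \<Rightarrow> (real ^ 'd \<Rightarrow> real) \<Rightarrow> (real ^ 'd) set" where
  "ess_support_on \<Omega> f =
     - \<Union>{U. open U \<and> (AE x in lebesgue. x \<in> U \<inter> \<Omega> \<longrightarrow> f x = 0)}"


subsection \<open>Triangulations and uniform refinement\<close>

text \<open>The library predicate \<^const>\<open>triangulation\<close> requires finiteness and that two (closed)
  simplices always meet in a common (possibly empty) face.\<close>

definition triangulation_of :: "(real ^ 'd) set \<Rightarrow> (real ^ 'd) set set \<Rightarrow> bool" where
  "triangulation_of \<Omega> \<T> \<longleftrightarrow>
     triangulation \<T> \<and> (\<forall>S\<in>\<T>. int CARD('d) simplex S) \<and> \<Union>\<T> = closure \<Omega>"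

definition vertices :: "(real ^ 'd) set \<Rightarrow> (real ^ 'd) set" where
  "vertices S = {v. v extreme_point_of S}"

text \<open>Regular (``red'') refinement at the edge midpoints: every \<open>d\<close>-simplex is cut into \<open>2^d\<close>
  simplices of equal volume whose vertices are vertices or edge midpoints of the parent (note
  \<open>midpoint u u = u\<close>), the half-size copies at its corners being among them. For \<open>d \<le> 3\<close> this leaves
  only the choice of the inner diagonal when \<open>d = 3\<close>; Freudenthal's and Bey's refinements are
  instances for every \<open>d\<close>.\<close>

definition uniform_refinement :: "(real ^ 'd) set set \<Rightarrow> (real ^ 'd) set set \<Rightarrow> bool" where
  "uniform_refinement \<T> \<T>' \<longleftrightarrow>
     (\<forall>S'\<in>\<T>'. \<exists>S\<in>\<T>. S' \<subseteq> S) \<and>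
     (\<forall>S\<in>\<T>.
        \<Union>{S'\<in>\<T>'. S' \<subseteq> S} = S \<and>
        card {S'\<in>\<T>'. S' \<subseteq> S} = 2 ^ CARD('d) \<and>
        (\<forall>S'\<in>\<T>'. S' \<subseteq> S \<longrightarrow>
           measure lebesgue S' = measure lebesgue S / 2 ^ CARD('d) \<and>
           vertices S' \<subseteq> {midpoint u v | u v. u \<in> vertices S \<and> v \<in> vertices S}) \<and>
        (\<forall>v\<in>vertices S. midpoint v ` S \<in> \<T>'))"


subsection \<open>The finite element space\<close>

text \<open>Functions on \<open>\<Omega>\<close> are represented by total functions of which only the values on \<open>\<Omega>\<close> matter.\<close>

definition fe_space :: "(real ^ 'd) set \<Rightarrow> (real ^ 'd) set set \<Rightarrow> (real ^ 'd \<Rightarrow> real) set" where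
  "fe_space \<Omega> \<T> =
     {g. continuous_on \<Omega> g \<and>
         (\<forall>S\<in>\<T>. \<exists>b c. \<forall>x\<in>S \<inter> \<Omega>. g x = b \<bullet> x + c) \<and>
         (LINT x:\<Omega>|lebesgue. g x) = 0}"

definition basis_on ::
  "(real ^ 'd) set \<Rightarrow> (real ^ 'd \<Rightarrow> real) set \<Rightarrow> ('m::finite \<Rightarrow> real ^ 'd \<Rightarrow> real) \<Rightarrow> bool" where
  "basis_on \<Omega> W \<phi> \<longleftrightarrow>
     (\<forall>p. \<phi> p \<in> W) \<and>
     (\<forall>c. (\<forall>x\<in>\<Omega>. (\<Sum>p\<in>UNIV. c p * \<phi> p x) = 0) \<longrightarrow> (\<forall>p. c p = 0)) \<and>
     (\<forall>g\<in>W. \<exists>c. \<forall>x\<in>\<Omega>. g x = (\<Sum>p\<in>UNIV. c p * \<phi> p x))"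

text \<open>Unspecified where \<open>g\<close> is not differentiable; for a finite element function that is a null set.\<close>

definition gradient :: "('a::real_inner \<Rightarrow> real) \<Rightarrow> 'a \<Rightarrow> 'a" where
  "gradient g x = (THE D. GDERIV g x :> D)"


subsection \<open>The discrete energy\<close>

text \<open>\<open>T\<close> enumerates the simplices of the coarse triangulation by the finite type \<open>'N\<close>, and \<open>\<phi>\<close> the
  basis functions by the finite type \<open>'m\<close>.\<close>

definition local_stiffness ::
  "('m::finite \<Rightarrow> real ^ 'd \<Rightarrow> real) \<Rightarrow> (real ^ 'd) set \<Rightarrow> real ^ 'm ^ 'm" where
  "local_stiffness \<phi> S =
     (\<chi> p q. LINT x:S|lebesgue. gradient (\<phi> p) x \<bullet> gradient (\<phi> q) x)"

definition stiffness ::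
  "real \<Rightarrow> ('N::finite \<Rightarrow> (real ^ 'd) set) \<Rightarrow> ('m::finite \<Rightarrow> real ^ 'd \<Rightarrow> real)
     \<Rightarrow> real ^ 'N \<Rightarrow> real ^ 'm ^ 'm" where
  "stiffness \<delta> T \<phi> \<mu> = (\<Sum>i\<in>UNIV. (\<mu> $ i + \<delta>) *\<^sub>R local_stiffness \<phi> (T i))"

definition load_vector ::
  "(real ^ 'd) set \<Rightarrow> (real ^ 'd \<Rightarrow> real) \<Rightarrow> ('m::finite \<Rightarrow> real ^ 'd \<Rightarrow> real) \<Rightarrow> real ^ 'm" where
  "load_vector \<Omega> f \<phi> = (\<chi> p. LINT x:\<Omega>|lebesgue. f x * \<phi> p x)"

definition volume_vector :: "('N::finite \<Rightarrow> (real ^ 'd) set) \<Rightarrow> real ^ 'N" where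
  "volume_vector T = (\<chi> i. measure lebesgue (T i))"

definition energy_E ::
  "(real ^ 'd) set \<Rightarrow> (real ^ 'd \<Rightarrow> real) \<Rightarrow> real \<Rightarrow> ('N::finite \<Rightarrow> (real ^ 'd) set)
     \<Rightarrow> ('m::finite \<Rightarrow> real ^ 'd \<Rightarrow> real) \<Rightarrow> real ^ 'N \<Rightarrow> real" where
  "energy_E \<Omega> f \<delta> T \<phi> \<mu> =
     load_vector \<Omega> f \<phi> \<bullet> (matrix_inv (stiffness \<delta> T \<phi> \<mu>) *v load_vector \<Omega> f \<phi>)
     + \<mu> \<bullet> volume_vector T"

definition energy_F ::
  "(real ^ 'd) set \<Rightarrow> (real ^ 'd \<Rightarrow> real) \<Rightarrow> real \<Rightarrow> ('N::finite \<Rightarrow> (real ^ 'd) set)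
     \<Rightarrow> ('m::finite \<Rightarrow> real ^ 'd \<Rightarrow> real) \<Rightarrow> real ^ 'N \<Rightarrow> real" where
  "energy_F \<Omega> f \<delta> T \<phi> \<sigma> = energy_E \<Omega> f \<delta> T \<phi> (\<chi> i. (\<sigma> $ i)\<^sup>2)"


subsection \<open>Gradient flows\<close>

definition real_analytic_on :: "(real \<Rightarrow> 'a::real_normed_vector) \<Rightarrow> real set \<Rightarrow> bool"
    (infix "real'_analytic'_on" 50) where
  "\<sigma> real_analytic_on I \<longleftrightarrow>
     (\<forall>t\<in>I. \<exists>a. \<exists>r>0. \<forall>s. \<bar>s - t\<bar> < r \<longrightarrow> (\<lambda>k. (s - t) ^ k *\<^sub>R a k) sums \<sigma> s)"

text \<open>The existence of the gradient of \<open>F\<close> along the curve is part of the notion of solution. The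
  initial value is attained continuously, and values at negative times are irrelevant.\<close>

definition classical_gradient_flow ::
  "('a::real_inner \<Rightarrow> real) \<Rightarrow> 'a \<Rightarrow> (real \<Rightarrow> 'a) \<Rightarrow> bool" where
  "classical_gradient_flow F \<sigma>0 \<sigma> \<longleftrightarrow>
     continuous_on {0..} \<sigma> \<and> \<sigma> 0 = \<sigma>0 \<and>
     (\<forall>t>0. \<exists>D. GDERIV F (\<sigma> t) :> D \<and> (\<sigma> has_vector_derivative - D) (at t))"

end

theory Submission
  imports Defs
begin

text \<open>Write \<open>u\<close> for the solution of \<open>A(\<sigma>^2) u = f\<close>. Then \<open>F\<close> has the gradient
  \<open>2 * \<sigma>_i * (a_i - u \<bullet> (K_i *v u))\<close>. In the energy norm of \<open>A(\<sigma>^2)\<close> every factor \<open>\<sigma>_i\<close> is absorbed by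
  the seminorm of \<open>K_i\<close>, so this field is globally Lipschitz, and Picard iteration gives a unique global
  solution. By Cramer's rule the derivatives of the functions \<open>\<sigma>_i\<close> and \<open>1 / det A(\<sigma>^2)\<close> along the flow
  are polynomials in these same functions. This bounds the \<open>k\<close>-th derivatives by \<open>C^k * k!\<close>, and
  Taylor's formula gives analyticity. The sum of the stiffness matrices is definite because a finite
  element function with vanishing gradient is constant on the connected cube, and its mean is zero.\<close>

subsection \<open>Analyticity of polynomially closed families\<close>

text \<open>Two obstacles shape the proof. The weights are unbounded, so a Lipschitz constant
  independent of \<sigma> is not evident. The shift \<open>\<epsilon>\<close> bounds each seminorm
  by the energy norm at the price \<open>1 / sqrt \<epsilon>\<close>, while the weight
  \<open>(\<sigma> $ i)\<^sup>2\<close> pays for one factor \<open>\<bar>\<sigma> $ i\<bar>\<close>.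
  After \<open>(\<tau> $ i)\<^sup>2 - (\<sigma> $ i)\<^sup>2\<close> is factored, only one such
  factor per term is left to be paid for. The field is moreover rational in \<sigma>, not
  polynomial. Adjoining the reciprocal determinant as a further unknown removes the division,
  because the derivative of \<open>1 / D\<close> is minus \<open>D'\<close> times the square of
  \<open>1 / D\<close>, again a polynomial in the family. The gradient of \<open>F\<close> is found
  without differentiating \<open>u\<close>: the increment of \<open>F\<close> is a sum of
  differences of squares times factors that only have to be continuous.\<close>

text \<open>\<open>e\<close> bounds the degree and \<open>K\<close> the sum of the absolute values of the coefficients.\<close>

inductive poly_bd :: "(real \<Rightarrow> real) set \<Rightarrow> nat \<Rightarrow> real \<Rightarrow> (real \<Rightarrow> real) \<Rightarrow> bool"
  for S where
  gen: "x \<in> S \<Longrightarrow> poly_bd S 1 1 x"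
| const: "poly_bd S 0 \<bar>c\<bar> (\<lambda>_. c)"
| add: "poly_bd S e K f \<Longrightarrow> poly_bd S e K' g \<Longrightarrow> poly_bd S e (K + K') (\<lambda>t. f t + g t)"
| mult: "poly_bd S e K f \<Longrightarrow> poly_bd S e' K' g \<Longrightarrow> poly_bd S (e + e') (K * K') (\<lambda>t. f t * g t)"
| weaken: "poly_bd S e K f \<Longrightarrow> e \<le> e' \<Longrightarrow> K \<le> K' \<Longrightarrow> poly_bd S e' K' f"

lemma poly_bd_nonneg: "poly_bd S e K f \<Longrightarrow> 0 \<le> K"
  by (induction rule: poly_bd.induct) auto

text \<open>Since \<open>1 \<le> R\<close>, a monomial of degree at most \<open>e\<close> is bounded
  by \<open>R ^ e\<close>, so overestimating the degree by \<open>weaken\<close> does no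
  harm.\<close>

lemma poly_bd_abs_le:
  assumes "poly_bd S e K f" and "\<And>x. x \<in> S \<Longrightarrow> \<bar>x t\<bar> \<le> R" and "1 \<le> R"
  shows "\<bar>f t\<bar> \<le> K * R ^ e"
  using assms(1)
proof induction
  case (gen x)
  then show ?case using assms(2) by simp
next
  case (const c)
  then show ?case by simp
next
  case (add e K f K' g)
  then show ?case by (simp add: distrib_right)
next
  case (mult e K f e' K' g)
  have "\<bar>f t\<bar> * \<bar>g t\<bar> \<le> (K * R ^ e) * (K' * R ^ e')"
    using mult.IH poly_bd_nonneg[OF mult.hyps(1)] \<open>1 \<le> R\<close> by (intro mult_mono) auto
  then show ?case by (simp add: abs_mult power_add mult_ac)
next
  case (weaken e K f e' K')
  have "K * R ^ e \<le> K' * R ^ e'"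
    using weaken.hyps poly_bd_nonneg[OF weaken.hyps(1)] \<open>1 \<le> R\<close>
    by (intro mult_mono power_increasing) auto
  with weaken.IH show ?case by linarith
qed

text \<open>By the product rule a monomial of degree \<open>e\<close> yields at most
  \<open>e\<close> terms, each with one generator replaced by its derivative: hence the factor
  \<open>e * C\<close> and the degree shift \<open>d\<close>. The larger set \<open>S'\<close>
  serves the determinant, a polynomial in the coordinates alone whose derivative along the flow also
  involves the reciprocal determinant.\<close>

lemma poly_bd_has_derivative:
  assumes "poly_bd S e K f" and "S \<subseteq> S'"
    and der: "\<And>x. x \<in> S \<Longrightarrow> \<exists>x'. (\<forall>t\<in>I. (x has_real_derivative x' t) (at t)) \<and> poly_bd S' (1 + d) C x'"
    and "0 \<le> C"
  shows "\<exists>f'. (\<forall>t\<in>I. (f has_real_derivative f' t) (at t)) \<and> poly_bd S' (e + d) (K * e * C) f'"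
  using assms(1)
proof induction
  case (gen x)
  then show ?case using der by simp
next
  case (const c)
  have "poly_bd S' (0 + d) 0 (\<lambda>_. 0)"
    using poly_bd.weaken[OF poly_bd.const[of S' 0], of d 0] by simp
  then show ?case by (intro exI[of _ "\<lambda>_. 0"]) auto
next
  case (add e K f K' g)
  then obtain f' g' where *: "\<forall>t\<in>I. (f has_real_derivative f' t) (at t)"
    "\<forall>t\<in>I. (g has_real_derivative g' t) (at t)"
    "poly_bd S' (e + d) (K * e * C) f'" "poly_bd S' (e + d) (K' * e * C) g'" by blast
  show ?case
  proof (intro exI conjI ballI)
    show "((\<lambda>t. f t + g t) has_real_derivative f' t + g' t) (at t)" if "t \<in> I" for t
      using * that by (auto intro: DERIV_add)
    show "poly_bd S' (e + d) ((K + K') * e * C) (\<lambda>t. f' t + g' t)"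
      using poly_bd.add[OF *(3,4)] by (simp add: distrib_right)
  qed
next
  case (mult e K f e' K' g)
  then obtain f' g' where *: "\<forall>t\<in>I. (f has_real_derivative f' t) (at t)"
    "\<forall>t\<in>I. (g has_real_derivative g' t) (at t)"
    "poly_bd S' (e + d) (K * e * C) f'" "poly_bd S' (e' + d) (K' * e' * C) g'" by blast
  have mono: "poly_bd S' k B h" if "poly_bd S k B h" for k B h
    using that \<open>S \<subseteq> S'\<close> by induction (blast intro: poly_bd.intros)+
  show ?case
  proof (intro exI conjI ballI)
    show "((\<lambda>t. f t * g t) has_real_derivative f' t * g t + f t * g' t) (at t)" if "t \<in> I" for t
      using * that by (auto intro!: derivative_eq_intros)
    have "poly_bd S' (e + e' + d) (K * e * C * K') (\<lambda>t. f' t * g t)"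
      using poly_bd.mult[OF *(3) mono[OF mult.hyps(2)]] by (simp add: add_ac)
    moreover have "poly_bd S' (e + e' + d) (K * (K' * e' * C)) (\<lambda>t. f t * g' t)"
      using poly_bd.mult[OF mono[OF mult.hyps(1)] *(4)] by (simp add: add_ac)
    ultimately have "poly_bd S' (e + e' + d) (K * e * C * K' + K * (K' * e' * C)) (\<lambda>t. f' t * g t + f t * g' t)"
      by (rule poly_bd.add)
    then show "poly_bd S' (e + e' + d) (K * K' * real (e + e') * C) (\<lambda>t. f' t * g t + f t * g' t)"
      by (simp add: algebra_simps)
  qed
next
  case (weaken e K f e' K')
  then obtain f' where *: "\<forall>t\<in>I. (f has_real_derivative f' t) (at t)"
    "poly_bd S' (e + d) (K * e * C) f'" by blast
  have "K * e * C \<le> K' * e' * C"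
    using weaken.hyps poly_bd_nonneg[OF weaken.hyps(1)] \<open>0 \<le> C\<close>
    by (intro mult_mono) auto
  then show ?case using poly_bd.weaken[OF *(2)] * weaken.hyps by (meson add_le_cancel_right)
qed

section \<open>Polynomials in a family, with degree and mass left implicit\<close>

definition poly_in :: "(real \<Rightarrow> real) set \<Rightarrow> (real \<Rightarrow> real) \<Rightarrow> bool" where
  "poly_in S f \<longleftrightarrow> (\<exists>e K. poly_bd S e K f)"

lemma poly_in_gen: "x \<in> S \<Longrightarrow> poly_in S x"
  and poly_in_const: "poly_in S (\<lambda>_. c)"
  unfolding poly_in_def using poly_bd.intros by blast+

lemma poly_in_mult: "poly_in S f \<Longrightarrow> poly_in S g \<Longrightarrow> poly_in S (\<lambda>t. f t * g t)"
  unfolding poly_in_def using poly_bd.mult by blast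

lemma poly_in_add:
  assumes "poly_in S f" "poly_in S g" shows "poly_in S (\<lambda>t. f t + g t)"
proof -
  obtain e K e' K' where *: "poly_bd S e K f" "poly_bd S e' K' g"
    using assms unfolding poly_in_def by blast
  then have "poly_bd S (max e e') K f" "poly_bd S (max e e') K' g"
    by (auto intro: poly_bd.weaken)
  then show ?thesis unfolding poly_in_def using poly_bd.add by blast
qed

lemma poly_in_diff: "poly_in S f \<Longrightarrow> poly_in S g \<Longrightarrow> poly_in S (\<lambda>t. f t - g t)"
  using poly_in_add[of S f "\<lambda>t. (-1) * g t"] poly_in_mult[OF poly_in_const, of S g "-1"] by simp

lemma poly_in_power: "poly_in S f \<Longrightarrow> poly_in S (\<lambda>t. f t ^ k)"
  by (induction k) (auto intro: poly_in_mult poly_in_const)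

lemma poly_in_sum:
  assumes "\<And>i. i \<in> J \<Longrightarrow> poly_in S (f i)" shows "poly_in S (\<lambda>t. \<Sum>i\<in>J. f i t)"
  using assms by (induction J rule: infinite_finite_induct) (auto intro: poly_in_const poly_in_add)

lemma poly_in_prod:
  assumes "\<And>i. i \<in> J \<Longrightarrow> poly_in S (f i)" shows "poly_in S (\<lambda>t. \<Prod>i\<in>J. f i t)"
  using assms by (induction J rule: infinite_finite_induct) (auto intro: poly_in_const poly_in_mult)

lemma poly_in_det:
  assumes "\<And>i j. poly_in S (\<lambda>t. M t $ i $ j)" shows "poly_in S (\<lambda>t. det (M t))"
  unfolding det_def by (intro poly_in_sum poly_in_mult poly_in_const poly_in_prod assms)

lemmas poly_in_intros = poly_in_const poly_in_mult poly_in_add poly_in_diff poly_in_power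
  poly_in_sum poly_in_prod poly_in_det

lemma poly_in_common_bound:
  assumes "finite F" and "\<And>f. f \<in> F \<Longrightarrow> poly_in S f"
  shows "\<exists>e K. \<forall>f\<in>F. poly_bd S e K f"
  using assms
proof (induction F)
  case empty
  show ?case by simp
next
  case (insert f F)
  have "\<exists>e K. \<forall>f\<in>F. poly_bd S e K f" using insert.IH insert.prems by simp
  moreover have "\<exists>e K. poly_bd S e K f" using insert.prems[of f] by (simp add: poly_in_def)
  ultimately obtain e K e' K' where *: "\<forall>f\<in>F. poly_bd S e K f" "poly_bd S e' K' f"
    by auto
  have "\<forall>g\<in>insert f F. poly_bd S (max e e') (max K K') g"
    using * by (auto intro: poly_bd.weaken)
  then show ?case by blast
qed

text \<open>Repeated differentiation may hit any generator at any stage, so one pair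
  \<open>d\<close>, \<open>C\<close> has to serve all of them; finiteness of \<open>S\<close>
  provides it.\<close>

lemma poly_in_derivatives_uniform:
  assumes "finite S"
    and "\<And>x. x \<in> S \<Longrightarrow> \<exists>x'. (\<forall>t\<in>I. (x has_real_derivative x' t) (at t)) \<and> poly_in S' x'"
  obtains d C where "0 \<le> C"
    and "\<And>x. x \<in> S \<Longrightarrow> \<exists>x'. (\<forall>t\<in>I. (x has_real_derivative x' t) (at t)) \<and> poly_bd S' (1 + d) C x'"
proof -
  obtain D where D: "\<And>x. x \<in> S \<Longrightarrow> (\<forall>t\<in>I. (x has_real_derivative D x t) (at t)) \<and> poly_in S' (D x)"
    using assms(2) by metis
  then obtain d C where C: "\<forall>f\<in>D ` S. poly_bd S' d C f"
    using poly_in_common_bound[of "D ` S" S'] assms(1) by auto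
  show thesis
  \<comment> \<open>The maximum covers empty \<open>S\<close>, where nothing forces \<open>C\<close>
    to be nonnegative.\<close>
  proof (rule that[of "max 0 C" d])
    show "\<exists>x'. (\<forall>t\<in>I. (x has_real_derivative x' t) (at t)) \<and> poly_bd S' (1 + d) (max 0 C) x'"
      if "x \<in> S" for x
      using D[OF that] C that by (intro exI[of _ "D x"]) (auto intro: poly_bd.weaken)
  qed auto
qed

lemma poly_in_has_derivative:
  assumes "poly_in S f" "finite S" "S \<subseteq> S'"
    and "\<And>x. x \<in> S \<Longrightarrow> \<exists>x'. (\<forall>t\<in>I. (x has_real_derivative x' t) (at t)) \<and> poly_in S' x'"
  shows "\<exists>f'. (\<forall>t\<in>I. (f has_real_derivative f' t) (at t)) \<and> poly_in S' f'"
proof -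
  obtain d C where *: "0 \<le> C"
    "\<And>x. x \<in> S \<Longrightarrow> \<exists>x'. (\<forall>t\<in>I. (x has_real_derivative x' t) (at t)) \<and> poly_bd S' (1 + d) C x'"
    using poly_in_derivatives_uniform[OF assms(2,4)] by metis
  then show ?thesis
    using assms(1,3) poly_bd_has_derivative[OF _ assms(3) *(2) *(1)] unfolding poly_in_def by blast
qed

text \<open>The factors are the degrees met in \<open>k\<close> successive differentiations. Each is
  at most \<open>(e + d) * (l + 1)\<close>, which leaves a geometric term times the factorial that
  Taylor's formula divides out.\<close>

lemma prod_linear_le_fact:
  "(\<Prod>l<k. real (e + l * d)) \<le> real (e + d) ^ k * fact k"
proof -
  have "(\<Prod>l<k. real (e + l * d)) \<le> (\<Prod>l<k. real (e + d) * real (Suc l))"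
  proof (rule prod_mono, safe)
    fix l
    have "e + l * d \<le> (e + d) * Suc l" by (simp add: algebra_simps)
    then show "real (e + l * d) \<le> real (e + d) * real (Suc l)"
      by (metis of_nat_le_iff of_nat_mult)
  qed auto
  also have "\<dots> = real (e + d) ^ k * fact k"
    by (simp add: prod.distrib fact_prod_Suc lessThan_atLeast0)
  finally show ?thesis .
qed

text \<open>In Lagrange's remainder of order \<open>n\<close> the factorials cancel and leave at
  most \<open>B * q ^ n\<close> with \<open>q = Q * \<bar>s - c\<bar> < 1\<close>.\<close>

lemma sums_Taylor_of_factorial_bound:
  fixes D :: "nat \<Rightarrow> real \<Rightarrow> real"
  assumes der: "\<And>k t. \<bar>t - c\<bar> < \<rho> \<Longrightarrow> (D k has_real_derivative D (Suc k) t) (at t)"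
    and bd: "\<And>k t. \<bar>t - c\<bar> < \<rho> \<Longrightarrow> \<bar>D k t\<bar> \<le> B * Q ^ k * fact k"
    and "0 \<le> B" "0 < Q" and s: "\<bar>s - c\<bar> < \<rho>" "\<bar>s - c\<bar> < 1 / Q"
  shows "(\<lambda>k. (s - c) ^ k * (D k c / fact k)) sums D 0 s"
\<comment> \<open>Lagrange's form needs two distinct points; at the centre only the term of index 0
  survives.\<close>
proof (cases "s = c")
  case True
  then show ?thesis
    using sums_If_finite_set[of "{0}" "\<lambda>k. (s - c) ^ k * (D k c / fact k)"]
      powser_sums_zero[of "\<lambda>k. D k c / fact k"] by (simp add: mult.commute)
next
  case False
  define q where "q = Q * \<bar>s - c\<bar>"
  have q: "0 \<le> q" "q < 1" using assms by (auto simp: q_def field_simps)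
  have rem: "\<bar>D 0 s - (\<Sum>k<n. (s - c) ^ k * (D k c / fact k))\<bar> \<le> B * q ^ n" if "n > 0" for n
  proof -
    have "\<exists>t. (if s < c then s < t \<and> t < c else c < t \<and> t < s) \<and>
      D 0 s = (\<Sum>m<n. (D m c / fact m) * (s - c) ^ m) + (D n t / fact n) * (s - c) ^ n"
    proof (rule Taylor[OF that refl])
      show "\<forall>m t. m < n \<and> min s c \<le> t \<and> t \<le> max s c \<longrightarrow> (D m has_real_derivative D (Suc m) t) (at t)"
        using s by (auto intro!: der)
    qed (use False in auto)
    then obtain t where t: "\<bar>t - c\<bar> < \<rho>"
      "D 0 s = (\<Sum>m<n. (D m c / fact m) * (s - c) ^ m) + (D n t / fact n) * (s - c) ^ n"
      using s False by (cases "s < c") (simp_all, (smt (verit))+)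
    have "\<bar>(D n t / fact n) * (s - c) ^ n\<bar> = \<bar>D n t\<bar> / fact n * \<bar>s - c\<bar> ^ n"
      by (simp add: abs_mult power_abs)
    also have "\<dots> \<le> (B * Q ^ n * fact n) / fact n * \<bar>s - c\<bar> ^ n"
      using bd[OF t(1), of n] by (intro mult_right_mono divide_right_mono) auto
    also have "\<dots> = B * q ^ n" by (simp add: q_def power_mult_distrib)
    finally show ?thesis using t(2) by (simp add: mult.commute)
  qed
  have "(\<lambda>n. B * q ^ n) \<longlonglongrightarrow> 0"
    using tendsto_mult_right_zero[OF LIMSEQ_power_zero[of q]] q by simp
  then have "(\<lambda>n. D 0 s - (\<Sum>k<n. (s - c) ^ k * (D k c / fact k))) \<longlonglongrightarrow> 0"
    by (rule Lim_null_comparison[rotated])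
       (use rem in \<open>auto simp only: real_norm_def intro!: eventually_sequentiallyI[of 1]\<close>)
  then have "(\<lambda>n. D 0 s - (D 0 s - (\<Sum>k<n. (s - c) ^ k * (D k c / fact k)))) \<longlonglongrightarrow> D 0 s - 0"
    by (intro tendsto_intros)
  then show ?thesis unfolding sums_def by simp
qed

text \<open>Each differentiation of a polynomial of degree \<open>e\<close> in the members of \<open>S\<close> raises the degree
  by the fixed amount \<open>d\<close> and multiplies the coefficient mass by at most \<open>e * C\<close>. So the \<open>k\<close>-th
  derivative is of size \<open>Q ^ k * fact k\<close>.\<close>

lemma power_series_of_poly_closed:
  assumes "finite S" and "0 < \<rho>"
    and der: "\<And>x. x \<in> S \<Longrightarrow> \<exists>x'. (\<forall>t. \<bar>t - c\<bar> < \<rho> \<longrightarrow> (x has_real_derivative x' t) (at t)) \<and> poly_in S x'"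
    and bd: "\<And>x t. x \<in> S \<Longrightarrow> \<bar>t - c\<bar> < \<rho> \<Longrightarrow> \<bar>x t\<bar> \<le> R"
    and "x \<in> S"
  shows "\<exists>a. \<exists>r>0. \<forall>s. \<bar>s - c\<bar> < r \<longrightarrow> (\<lambda>k. (s - c) ^ k * a k) sums x s"
proof -
  define I where "I = {t. \<bar>t - c\<bar> < \<rho>}"
  have "\<exists>x'. (\<forall>t\<in>I. (x has_real_derivative x' t) (at t)) \<and> poly_in S x'" if "x \<in> S" for x
    using der[OF that] by (simp add: I_def)
  from poly_in_derivatives_uniform[OF \<open>finite S\<close> this]
  obtain d C where "0 \<le> C"
    and C: "\<And>x. x \<in> S \<Longrightarrow> \<exists>x'. (\<forall>t\<in>I. (x has_real_derivative x' t) (at t)) \<and> poly_bd S (1 + d) C x'"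
    by metis
  define K where "K k = (\<Prod>l<k. real (1 + l * d) * C)" for k
  \<comment> \<open>The derivatives are only known to exist with bounds, so they are chosen
    recursively with the bound as invariant; the clause for \<open>k = 0\<close> pins the start to
    \<open>x\<close>.\<close>
  have "\<exists>D. \<forall>k. (poly_bd S (1 + k * d) (K k) (D k) \<and> (k = 0 \<longrightarrow> D k = x)) \<and>
      (\<forall>t\<in>I. (D k has_real_derivative D (Suc k) t) (at t))"
  proof (rule dependent_nat_choice)
    show "\<exists>y. poly_bd S (1 + 0 * d) (K 0) y \<and> (0 = (0::nat) \<longrightarrow> y = x)"
      using poly_bd.gen[OF \<open>x \<in> S\<close>] by (auto simp: K_def)
    fix y k
    assume y: "poly_bd S (1 + k * d) (K k) y \<and> (k = 0 \<longrightarrow> y = x)"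
    obtain y' where "\<forall>t\<in>I. (y has_real_derivative y' t) (at t)"
      "poly_bd S (1 + k * d + d) (K k * real (1 + k * d) * C) y'"
      using poly_bd_has_derivative[OF conjunct1[OF y] order_refl C \<open>0 \<le> C\<close>] by blast
    then show "\<exists>y'. (poly_bd S (1 + Suc k * d) (K (Suc k)) y' \<and> (Suc k = 0 \<longrightarrow> y' = x)) \<and>
        (\<forall>t\<in>I. (y has_real_derivative y' t) (at t))"
      by (intro exI[of _ y']) (simp add: K_def algebra_simps)
  qed
  then obtain D where D: "\<And>k. poly_bd S (1 + k * d) (K k) (D k)" "D 0 = x"
    "\<And>k t. t \<in> I \<Longrightarrow> (D k has_real_derivative D (Suc k) t) (at t)" by metis
  define R' where "R' = max 1 R"
  \<comment> \<open>Of \<open>R' ^ (1 + k * d)\<close> the part growing with \<open>k\<close> goes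
    into \<open>Q ^ k\<close> and the remaining \<open>R'\<close> becomes the prefactor.
    \<open>C + 1\<close> keeps \<open>Q\<close> positive when \<open>C = 0\<close>.\<close>
  define Q where "Q = real (1 + d) * (C + 1) * R' ^ d"
  have "0 < Q" using \<open>0 \<le> C\<close> by (auto simp: Q_def R'_def)
  have K: "K k \<le> (real (1 + d) * (C + 1)) ^ k * fact k" for k
  proof -
    have "K k = (\<Prod>l<k. real (1 + l * d)) * C ^ k" by (simp add: K_def prod.distrib)
    also have "\<dots> \<le> (real (1 + d) ^ k * fact k) * (C + 1) ^ k"
      using \<open>0 \<le> C\<close> prod_linear_le_fact[of 1 d k] by (intro mult_mono power_mono) auto
    also have "\<dots> = (real (1 + d) * (C + 1)) ^ k * fact k"
      unfolding power_mult_distrib by simp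
    finally show ?thesis .
  qed
  have Dbd: "\<bar>D k t\<bar> \<le> R' * Q ^ k * fact k" if "\<bar>t - c\<bar> < \<rho>" for k t
  proof -
    have "\<bar>D k t\<bar> \<le> K k * R' ^ (1 + k * d)"
      using poly_bd_abs_le[OF D(1), of t R'] bd[OF _ that] by (force simp: R'_def)
    also have "\<dots> \<le> ((real (1 + d) * (C + 1)) ^ k * fact k) * R' ^ (1 + k * d)"
      using K by (intro mult_right_mono) (auto simp: R'_def)
    also have "\<dots> = R' * Q ^ k * fact k"
      by (simp add: Q_def power_mult_distrib power_mult[of R' d k, symmetric] mult_ac)
    finally show ?thesis .
  qed
  have "(\<lambda>k. (s - c) ^ k * (D k c / fact k)) sums D 0 s" if "\<bar>s - c\<bar> < min \<rho> (1 / Q)" for s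
    using that \<open>0 < Q\<close>
    by (intro sums_Taylor_of_factorial_bound[where \<rho> = \<rho> and B = R' and Q = Q] D(3) Dbd)
       (auto simp: I_def R'_def)
  then show ?thesis using \<open>0 < Q\<close> \<open>0 < \<rho>\<close> D(2)
    by (intro exI[of _ "\<lambda>k. D k c / fact k"] exI[of _ "min \<rho> (1 / Q)"]) auto
qed

text \<open>There are finitely many components, so the least of their radii is positive and serves
  the vector series.\<close>

lemma real_analytic_on_vecI:
  fixes y :: "real \<Rightarrow> real ^ 'n"
  assumes "\<And>i t. t \<in> I \<Longrightarrow> \<exists>a. \<exists>r>0. \<forall>s. \<bar>s - t\<bar> < r \<longrightarrow> (\<lambda>k. (s - t) ^ k * a k) sums (y s $ i)"
  shows "y real_analytic_on I"
  unfolding real_analytic_on_def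
proof
  fix t assume "t \<in> I"
  then obtain a r where ar: "\<And>i. r i > 0"
    "\<And>i s. \<bar>s - t\<bar> < r i \<Longrightarrow> (\<lambda>k. (s - t) ^ k * a i k) sums (y s $ i)"
    using assms by metis
  define \<rho> where "\<rho> = Min (range r)"
  have \<rho>: "\<rho> > 0" "\<And>i. \<rho> \<le> r i" using ar(1) by (auto simp: \<rho>_def)
  have "(\<lambda>k. (s - t) ^ k *\<^sub>R (\<chi> i. a i k)) sums y s" if "\<bar>s - t\<bar> < \<rho>" for s
    unfolding sums_def
  proof (rule vec_tendstoI)
    fix i
    have "(\<lambda>k. (s - t) ^ k * a i k) sums (y s $ i)"
      using ar(2)[of s i] that \<rho>(2)[of i] by linarith
    then show "(\<lambda>n. (\<Sum>k<n. (s - t) ^ k *\<^sub>R (\<chi> i. a i k)) $ i) \<longlonglongrightarrow> y s $ i"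
      by (simp add: sums_def)
  qed
  then show "\<exists>a. \<exists>r>0. \<forall>s. \<bar>s - t\<bar> < r \<longrightarrow> (\<lambda>k. (s - t) ^ k *\<^sub>R a k) sums y s"
    using \<rho>(1) by (intro exI[of _ "\<lambda>k. \<chi> i. a i k"] exI[of _ \<rho>]) auto
qed

subsection \<open>Globally Lipschitz differential equations\<close>

text \<open>The squared distance grows at rate at most \<open>2 * L\<close>, so multiplied by
  \<open>exp (- 2 * L * s)\<close> it is nonincreasing. Derivatives are used at positive times only;
  continuity carries the monotonicity to time 0.\<close>

lemma gronwall_unique:
  fixes G :: "'a::real_inner \<Rightarrow> 'a"
  assumes lip: "\<And>x y. norm (G x - G y) \<le> L * norm (x - y)"
    and cont: "continuous_on {0..} y" "continuous_on {0..} z"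
    and y: "\<And>t. t > 0 \<Longrightarrow> (y has_vector_derivative G (y t)) (at t)"
    and z: "\<And>t. t > 0 \<Longrightarrow> (z has_vector_derivative G (z t)) (at t)"
    and "y 0 = z 0" "0 \<le> t"
  shows "y t = z t"
proof -
  define w where "w s = y s - z s" for s
  define p where "p s = (w s \<bullet> w s) * exp (- 2 * L * s)" for s
  have "p t \<le> p 0"
  proof (rule DERIV_nonpos_imp_decreasing_open[OF \<open>0 \<le> t\<close>])
    show "continuous_on {0..t} p" unfolding p_def w_def
      by (intro continuous_intros continuous_on_subset[OF cont(1)] continuous_on_subset[OF cont(2)]) auto
  next
    fix s :: real assume "0 < s"
    define w' where "w' = G (y s) - G (z s)"
    have w: "(w has_vector_derivative w') (at s)"
      unfolding w_def w'_def by (intro derivative_intros y z \<open>0 < s\<close>)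
    have "((\<lambda>s. w s \<bullet> w s) has_vector_derivative (w s \<bullet> w' + w' \<bullet> w s)) (at s)"
      using bounded_bilinear.has_vector_derivative[OF bounded_bilinear_inner w w] .
    then have 1: "((\<lambda>s. w s \<bullet> w s) has_real_derivative (2 * (w s \<bullet> w'))) (at s)"
      by (simp add: has_real_derivative_iff_has_vector_derivative inner_commute)
    have "(p has_real_derivative (2 * (w s \<bullet> w') * exp (- 2 * L * s)
        + (w s \<bullet> w s) * (exp (- 2 * L * s) * (- 2 * L)))) (at s)"
      unfolding p_def by (rule derivative_eq_intros 1 refl | simp)+
    moreover have "w s \<bullet> w' \<le> L * (w s \<bullet> w s)"
    proof -
      have "w s \<bullet> w' \<le> norm (w s) * norm w'" by (rule norm_cauchy_schwarz)
      also have "\<dots> \<le> norm (w s) * (L * norm (w s))"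
        using lip[of "y s" "z s"] by (intro mult_left_mono) (auto simp: w_def w'_def)
      also have "\<dots> = L * (w s \<bullet> w s)" by (simp add: dot_square_norm power2_eq_square)
      finally show ?thesis .
    qed
    then have "(w s \<bullet> w' - L * (w s \<bullet> w s)) * (2 * exp (- 2 * L * s)) \<le> 0"
      by (intro mult_nonpos_nonneg) auto
    then have "2 * (w s \<bullet> w') * exp (- 2 * L * s)
        + (w s \<bullet> w s) * (exp (- 2 * L * s) * (- 2 * L)) \<le> 0"
      by (simp add: algebra_simps)
    ultimately show "\<exists>y. (p has_real_derivative y) (at s) \<and> y \<le> 0" by blast
  qed
  moreover have "p 0 = 0" using \<open>y 0 = z 0\<close> by (simp add: p_def w_def)
  ultimately have "w t \<bullet> w t \<le> 0" by (simp add: p_def mult_le_0_iff)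
  then have "w t = 0" by (metis inner_ge_zero inner_eq_zero_iff order_antisym)
  then show ?thesis by (simp add: w_def)
qed

text \<open>Picard's operator for the unknown \<open>z t = exp (- 2 * L * t) *\<^sub>R (y t - y0)\<close> is a contraction on all
  bounded continuous functions, so no restriction to short time intervals is needed.\<close>

lemma lipschitz_ode_exists:
  fixes G :: "'a::euclidean_space \<Rightarrow> 'a"
  assumes lip: "\<And>x y. norm (G x - G y) \<le> L * norm (x - y)" and "0 < L"
  shows "\<exists>y. continuous_on {0..} y \<and> y 0 = y0 \<and> (\<forall>t>0. (y has_vector_derivative G (y t)) (at t))"
proof -
  have Gcont: "continuous_on UNIV G"
    by (rule lipschitz_on_continuous_on[of L]) (auto intro!: lipschitz_onI simp: dist_norm lip \<open>0 < L\<close> less_imp_le)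
  \<comment> \<open>\<open>H z\<close> is the right-hand side along the curve \<open>y\<close>
    encoded by \<open>z\<close>.\<close>
  define H where "H z s = G (y0 + exp (2 * L * s) *\<^sub>R z s)" for z :: "real \<Rightarrow> 'a" and s
  \<comment> \<open>\<open>max 0 t\<close> makes \<open>P z\<close> vanish at negative times, so
    that the fixed point can be sought among bounded continuous functions on the whole line.\<close>
  define P where "P z t = exp (- 2 * L * max 0 t) *\<^sub>R integral {0..max 0 t} (H z)" for z t
  have Hcont: "continuous_on X (H z)" if "continuous_on UNIV z" for X z
    unfolding H_def
    by (rule continuous_on_compose2[OF Gcont])
       (auto intro!: continuous_intros continuous_on_subset[OF that])
  have exp_int: "((\<lambda>s. exp (2 * L * s)) has_integral (exp (2 * L * t) - 1) / (2 * L)) {0..t}"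
    if "0 \<le> t" for t
  proof -
    have "((\<lambda>s. exp (2 * L * s)) has_integral (exp (2 * L * t) / (2 * L) - exp (2 * L * 0) / (2 * L))) {0..t}"
      using \<open>0 < L\<close> that
      by (intro fundamental_theorem_of_calculus)
         (auto intro!: derivative_eq_intros simp flip: has_real_derivative_iff_has_vector_derivative)
    then show ?thesis by (simp add: diff_divide_distrib)
  qed
  have exp_le: "exp (- 2 * L * t) * ((exp (2 * L * t) - 1) / (2 * L)) \<le> 1 / (2 * L)" for t
    using \<open>0 < L\<close> by (simp add: field_simps exp_minus)
  have Hint: "H z integrable_on {0..t}" if "continuous_on UNIV z" for z t
    using Hcont[OF that] by (rule integrable_continuous_real)
  have Pcont: "continuous_on UNIV (P z)" if "continuous_on UNIV z" for z
  proof -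
    have "isCont (P z) t" for t
    proof -
      define b where "b = max 0 t + 1"
      have "continuous_on {0..b} (\<lambda>u. integral {0..u} (H z))"
        by (rule indefinite_integral_continuous_1[OF Hint[OF that]])
      then have "continuous_on {..b} (\<lambda>t. integral {0..max 0 t} (H z))"
        by (rule continuous_on_compose2) (auto intro!: continuous_intros simp: b_def)
      then have "continuous_on {..b} (P z)" unfolding P_def by (intro continuous_intros)
      then have "continuous_on {..<b} (P z)" by (rule continuous_on_subset) auto
      then show ?thesis by (auto simp: continuous_on_eq_continuous_at b_def)
    qed
    then show ?thesis by (simp add: continuous_on_eq_continuous_at)
  qed
  \<comment> \<open>The exponential rate \<open>2 * L\<close> is twice the Lipschitz constant:
    integrating \<open>L * exp (2 * L * s)\<close> and damping by \<open>exp (- 2 * L * t)\<close>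
    leaves at most \<open>L / (2 * L) = 1 / 2\<close>.\<close>
  have contraction: "norm (P z t - P w t) \<le> 1 / 2 * M"
    if "continuous_on UNIV z" "continuous_on UNIV w" "\<And>t. norm (z t - w t) \<le> M" for z w M t
  proof -
    define m where "m = max 0 t"
    have "0 \<le> M" using that(3)[of 0] norm_ge_zero order_trans by blast
    have "norm (integral {0..m} (\<lambda>s. H z s - H w s)) \<le> integral {0..m} (\<lambda>s. L * M * exp (2 * L * s))"
    proof (rule integral_norm_bound_integral)
      show "(\<lambda>s. H z s - H w s) integrable_on {0..m}" by (intro integrable_diff Hint that)
      show "(\<lambda>s. L * M * exp (2 * L * s)) integrable_on {0..m}"
        by (intro integrable_continuous_real continuous_intros)
      fix s
      have "norm (H z s - H w s) \<le> L * norm (exp (2 * L * s) *\<^sub>R (z s - w s))"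
        unfolding H_def using lip by (metis add_diff_cancel_left scaleR_right_diff_distrib)
      also have "\<dots> \<le> L * (exp (2 * L * s) * M)"
        using \<open>0 < L\<close> that(3)[of s] by simp
      finally show "norm (H z s - H w s) \<le> L * M * exp (2 * L * s)" by (simp add: mult_ac)
    qed
    also have "\<dots> = L * M * ((exp (2 * L * m) - 1) / (2 * L))"
      using integral_unique[OF exp_int[of m]] by (simp add: m_def)
    finally have "norm (P z t - P w t) \<le> exp (- 2 * L * m) * (L * M * ((exp (2 * L * m) - 1) / (2 * L)))"
      unfolding P_def m_def[symmetric]
      by (simp add: scaleR_right_diff_distrib[symmetric] integral_diff[OF Hint Hint, OF that(1,2), symmetric])
    also have "\<dots> = L * M * (exp (- 2 * L * m) * ((exp (2 * L * m) - 1) / (2 * L)))" by simp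
    also have "\<dots> \<le> L * M * (1 / (2 * L))"
      using exp_le[of m] \<open>0 < L\<close> \<open>0 \<le> M\<close> by (intro mult_left_mono) auto
    finally show ?thesis using \<open>0 < L\<close> by simp
  qed
  \<comment> \<open>\<open>G\<close> may be unbounded, so boundedness of \<open>P z\<close> is
    deduced from that of \<open>P 0\<close>, whose integrand is the constant \<open>G y0\<close>,
    and the contraction estimate.\<close>
  have P0: "norm (P (\<lambda>_. 0) t) \<le> norm (G y0) * (1 / (2 * L))" for t
  proof -
    define m where "m = max 0 t"
    have "norm (P (\<lambda>_. 0) t) = exp (- 2 * L * m) * (m * norm (G y0))"
      by (simp add: P_def H_def[abs_def] m_def)
    also have "\<dots> = norm (G y0) * (exp (- 2 * L * m) * m)" by simp
    also have "\<dots> \<le> norm (G y0) * (1 / (2 * L))"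
    proof (rule mult_left_mono)
      have "2 * L * m \<le> exp (2 * L * m)" using exp_ge_add_one_self[of "2 * L * m"] by linarith
      then show "exp (- 2 * L * m) * m \<le> 1 / (2 * L)"
        using \<open>0 < L\<close> by (simp add: divide_simps exp_minus mult_ac)
    qed auto
    finally show ?thesis .
  qed
  have Pbc: "P z \<in> bcontfun" if "z \<in> bcontfun" for z
  proof -
    have z: "continuous_on UNIV z" "bounded (range z)" using that by (auto simp: bcontfun_def)
    then obtain M where M: "\<And>t. norm (z t) \<le> M" by (auto simp: bounded_iff)
    have "norm (P z t) \<le> norm (G y0) * (1 / (2 * L)) + 1 / 2 * M" for t
      using contraction[OF z(1) continuous_on_const[of _ 0], of M t] M P0[of t]
        norm_triangle_ineq[of "P (\<lambda>_. 0) t" "P z t - P (\<lambda>_. 0) t"] by simp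
    then show ?thesis using Pcont[OF z(1)] by (auto simp: bcontfun_def bounded_iff)
  qed
  define \<Phi> where "\<Phi> z = Bcontfun (P (apply_bcontfun z))" for z
  have \<Phi>: "apply_bcontfun (\<Phi> z) = P (apply_bcontfun z)" for z
    unfolding \<Phi>_def by (intro Bcontfun_inverse Pbc apply_bcontfun)
  have "\<exists>!z. \<Phi> z = z"
  proof (rule banach_fix_type[of "1/2"])
    show "\<forall>z w. dist (\<Phi> z) (\<Phi> w) \<le> 1 / 2 * dist z w"
    proof (intro allI dist_bound)
      fix z w t
      show "dist (apply_bcontfun (\<Phi> z) t) (apply_bcontfun (\<Phi> w) t) \<le> 1 / 2 * dist z w"
        unfolding \<Phi> dist_norm[of "P _ _"]
        by (rule contraction) (use dist_bounded[of z _ w] in \<open>auto simp: dist_norm\<close>)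
    qed
  qed auto
  then obtain z where "\<Phi> z = z" by blast
  then have z: "apply_bcontfun z = P (apply_bcontfun z)" using \<Phi>[of z] by simp
  define y where "y t = y0 + integral {0..t} (H (apply_bcontfun z))" for t
  \<comment> \<open>Undoing the exponential substitution turns the fixed point equation into the
    integral equation for \<open>y\<close>.\<close>
  have Hz: "H (apply_bcontfun z) t = G (y t)" if "0 \<le> t" for t
  proof -
    have "apply_bcontfun z t = exp (- 2 * L * t) *\<^sub>R integral {0..t} (H (apply_bcontfun z))"
      using fun_cong[OF z, of t] that by (simp add: P_def max_def)
    then have "exp (2 * L * t) *\<^sub>R apply_bcontfun z t = integral {0..t} (H (apply_bcontfun z))"
      by (simp flip: exp_add)
    then show ?thesis by (simp add: H_def y_def)
  qed
  \<comment> \<open>The interval is closed at 0, so this includes a one-sided derivative there and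
    thereby continuity at the initial time.\<close>
  have der: "(y has_vector_derivative G (y t)) (at t within {0..b})" if "0 \<le> t" "t \<le> b" for t b
    using integral_has_vector_derivative[OF Hcont[OF continuous_on_apply_bcontfun], of t 0 b z] that Hz[of t]
    unfolding y_def by (auto intro!: derivative_eq_intros)
  show ?thesis
  proof (intro exI conjI allI impI)
    show "y 0 = y0" by (simp add: y_def)
    show "(y has_vector_derivative G (y t)) (at t)" if "0 < t" for t
      using der[of t "t + 1"] that by (simp add: at_within_Icc_at)
    show "continuous_on {0..} y"
      unfolding continuous_on_eq_continuous_within
    proof
      fix t :: real assume "t \<in> {0..}"
      then have "continuous (at t within {0..t+1}) y"
        by (intro has_vector_derivative_continuous[OF der]) auto
      moreover have "at t within {0..t+1} = at t within {0..}"
        by (rule at_within_nhd[of _ "{..<t+1}"]) auto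
      ultimately show "continuous (at t within {0..}) y" by (simp add: continuous_within)
    qed
  qed
qed

subsection \<open>The energy of a pencil of positive semidefinite matrices\<close>

text \<open>Cancels one norm from a quadratic estimate without excluding that it vanishes.\<close>

lemma le_of_mult_self_le:
  fixes x y :: "'a::linordered_idom"
  assumes "x * x \<le> x * y" "0 \<le> x" "0 \<le> y"
  shows "x \<le> y"
  using assms by (cases "x = 0") (simp_all add: mult_le_cancel_left)

text \<open>Positivity on \<open>B y y *\<^sub>R x - B x y *\<^sub>R y\<close> gives the inequality
  up to a factor \<open>B y y\<close>. The form may be degenerate; if \<open>B y y = 0\<close>, then
  \<open>B x x + 2 * t * B x y\<close> is nonnegative for all \<open>t\<close>, which forces
  \<open>B x y = 0\<close>.\<close>

lemma psd_cauchy_schwarz: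
  fixes B :: "'v::real_vector \<Rightarrow> 'v \<Rightarrow> real"
  assumes "\<And>x y. B x y = B y x" "\<And>x. 0 \<le> B x x"
    and "\<And>x y z. B x (y + z) = B x y + B x z" "\<And>c x y. B x (c *\<^sub>R y) = c * B x y"
  shows "\<bar>B x y\<bar> \<le> sqrt (B x x) * sqrt (B y y)"
proof -
  have ex: "B (s *\<^sub>R x + t *\<^sub>R y) (s *\<^sub>R x + t *\<^sub>R y) = s\<^sup>2 * B x x + 2 * s * t * B x y + t\<^sup>2 * B y y" for s t
    using assms(1)[of y x]
    by (simp add: assms(3,4) assms(1)[of "s *\<^sub>R x + t *\<^sub>R y"] power2_eq_square algebra_simps)
  have "0 \<le> (B y y)\<^sup>2 * B x x + 2 * B y y * (- B x y) * B x y + (- B x y)\<^sup>2 * B y y"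
    using assms(2)[of "B y y *\<^sub>R x + (- B x y) *\<^sub>R y"] unfolding ex .
  then have 1: "0 \<le> B y y * (B x x * B y y - (B x y)\<^sup>2)"
    by (simp add: power2_eq_square algebra_simps)
  have "(B x y)\<^sup>2 \<le> B x x * B y y"
  proof (cases "B y y = 0")
    case True
    have nonneg: "0 \<le> B x x + 2 * t * B x y" for t
      using assms(2)[of "1 *\<^sub>R x + t *\<^sub>R y"] unfolding ex using True by simp
    have "B x y = 0"
    proof (rule ccontr)
      assume "B x y \<noteq> 0"
      \<comment> \<open>This \<open>t\<close> gives the affine function the value -1.\<close>
      then have "2 * (- (B x x + 1) / (2 * B x y)) * B x y = - (B x x + 1)" by simp
      with nonneg[of "- (B x x + 1) / (2 * B x y)"] show False by linarith
    qed
    then show ?thesis using True by simp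
  next
    case False
    then have "0 < B y y" using assms(2)[of y] by simp
    with 1 show ?thesis by (simp add: zero_le_mult_iff)
  qed
  then have "sqrt ((B x y)\<^sup>2) \<le> sqrt (B x x * B y y)" by (rule real_sqrt_le_mono)
  then show ?thesis by (simp add: real_sqrt_mult)
qed

text \<open>A product rule in which the second factor is only continuous: the first factor vanishes
  at \<open>x\<close>, so no derivative of \<open>p\<close> enters.\<close>

lemma has_derivative_mult_increment:
  fixes k p :: "'v::real_normed_vector \<Rightarrow> real"
  assumes "(k has_derivative k') (at x)" and "isCont p x"
  shows "((\<lambda>y. (k y - k x) * p y) has_derivative (\<lambda>h. k' h * p x)) (at x)"
proof -
  have k': "bounded_linear k'" using assms(1) by (rule has_derivative_bounded_linear)
  have 1: "((\<lambda>y. (k y - k x - k' (y - x)) /\<^sub>R norm (y - x)) \<longlongrightarrow> 0) (at x)"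
    using assms(1) by (simp add: has_derivative_at_within)
  have 2: "(p \<longlongrightarrow> p x) (at x)" using assms(2) by (simp add: isCont_def)
  obtain B where B: "\<And>h. norm (k' h) \<le> norm h * B" using bounded_linear.bounded[OF k'] by blast
  \<comment> \<open>The quotient \<open>k' (y - x) /\<^sub>R norm (y - x)\<close> is merely bounded;
    the smallness comes from continuity of \<open>p\<close>.\<close>
  have 3: "((\<lambda>y. (k' (y - x) /\<^sub>R norm (y - x)) * (p y - p x)) \<longlongrightarrow> 0) (at x)"
  proof (rule Lim_null_comparison)
    show "\<forall>\<^sub>F y in at x. norm ((k' (y - x) /\<^sub>R norm (y - x)) * (p y - p x)) \<le> B * \<bar>p y - p x\<bar>"
      unfolding eventually_at_filter
    proof (intro always_eventually allI impI)
      fix y assume "y \<noteq> x"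
      then have "norm (k' (y - x) /\<^sub>R norm (y - x)) \<le> B"
        using B[of "y - x"] by (simp add: field_simps)
      then show "norm ((k' (y - x) /\<^sub>R norm (y - x)) * (p y - p x)) \<le> B * \<bar>p y - p x\<bar>"
        unfolding norm_mult by (metis abs_ge_zero mult_right_mono real_norm_def)
    qed
    show "((\<lambda>y. B * \<bar>p y - p x\<bar>) \<longlongrightarrow> 0) (at x)"
      using tendsto_mult_right_zero[OF tendsto_rabs_zero[OF LIM_zero[OF 2]]] by simp
  qed
  have "((\<lambda>y. ((k y - k x - k' (y - x)) /\<^sub>R norm (y - x)) * p y
      + (k' (y - x) /\<^sub>R norm (y - x)) * (p y - p x)) \<longlongrightarrow> 0 * p x + 0) (at x)"
    by (intro tendsto_add tendsto_mult 1 2 3)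
  moreover have "((k y - k x - k' (y - x)) /\<^sub>R norm (y - x)) * p y
      + (k' (y - x) /\<^sub>R norm (y - x)) * (p y - p x)
      = ((k y - k x) * p y - (k x - k x) * p x - k' (y - x) * p x) /\<^sub>R norm (y - x)" for y
    by (simp add: algebra_simps)
  ultimately show ?thesis
    unfolding has_derivative_at_within
    using bounded_linear_compose[OF bounded_linear_mult_left k', of "p x"] by simp
qed

lemma sum_abs_diff_le_card_norm: "(\<Sum>i\<in>UNIV. \<bar>\<tau> $ i - \<sigma> $ i\<bar>) \<le> CARD('n) * norm (\<sigma> - \<tau>)" for \<sigma> \<tau> :: "real ^ 'n"
proof -
  have "(\<Sum>i\<in>UNIV. \<bar>\<tau> $ i - \<sigma> $ i\<bar>) \<le> (\<Sum>i\<in>(UNIV::'n set). norm (\<sigma> - \<tau>))"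
    using component_le_norm_cart[of "\<sigma> - \<tau>"] by (intro sum_mono) (simp add: abs_minus_commute)
  then show ?thesis by simp
qed

text \<open>A single \<open>K i\<close> may be singular; only the joint kernel is trivial.
  \<open>\<epsilon>\<close> stands for the regularisation of the weights.\<close>

locale psd_pencil =
  fixes K :: "'N::finite \<Rightarrow> real ^ 'm::finite ^ 'm" and \<epsilon> :: real
    and f :: "real ^ 'm" and a :: "real ^ 'N"
  assumes sym: "x \<bullet> (K i *v y) = y \<bullet> (K i *v x)"
    and psd: "0 \<le> x \<bullet> (K i *v x)"
    and definite: "(\<And>i. x \<bullet> (K i *v x) = 0) \<Longrightarrow> x = 0"
    and eps: "0 < \<epsilon>"
begin

definition A where "A \<sigma> = (\<Sum>i\<in>UNIV. ((\<sigma> $ i)\<^sup>2 + \<epsilon>) *\<^sub>R K i)"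
definition u where "u \<sigma> = matrix_inv (A \<sigma>) *v f"
definition N where "N i x = sqrt (x \<bullet> (K i *v x))"
definition E where "E \<sigma> x y = (\<Sum>i\<in>UNIV. ((\<sigma> $ i)\<^sup>2 + \<epsilon>) * (x \<bullet> (K i *v y)))"
definition NE where "NE \<sigma> x = sqrt (E \<sigma> x x)"
definition F where "F \<sigma> = f \<bullet> u \<sigma> + (\<chi> i. (\<sigma> $ i)\<^sup>2) \<bullet> a"
text \<open>Raising the weight of \<open>K i\<close> changes the compliance
  \<open>f \<bullet> u\<close> at the rate \<open>- (u \<bullet> (K i *v u))\<close>; the factor
  \<open>2 * \<sigma> $ i\<close> is the chain rule for the square.\<close>

definition grad where "grad \<sigma> = (\<chi> i. 2 * \<sigma> $ i * (a $ i - u \<sigma> \<bullet> (K i *v u \<sigma>)))"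

section \<open>The energy form and its norms\<close>

lemma inner_A: "x \<bullet> (A \<sigma> *v y) = E \<sigma> x y"
proof -
  have "linear (\<lambda>B. B *v y)" for y :: "real ^ 'm"
    by (intro linearI) (auto simp: matrix_vector_mult_add_rdistrib scaleR_matrix_vector_assoc)
  from linear_sum[OF this]
  have "A \<sigma> *v y = (\<Sum>i\<in>UNIV. (((\<sigma> $ i)\<^sup>2 + \<epsilon>) *\<^sub>R K i) *v y)"
    unfolding A_def by blast
  then show ?thesis by (simp add: E_def inner_sum_right scaleR_matrix_vector_assoc[symmetric])
qed

lemma E_sym: "E \<sigma> x y = E \<sigma> y x"
  unfolding E_def by (subst sym) simp

lemma weight_pos: "0 < (\<sigma> $ i)\<^sup>2 + \<epsilon>"
  using eps by (simp add: add_nonneg_pos)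

lemma weight_le_E: "((\<sigma> $ i)\<^sup>2 + \<epsilon>) * (x \<bullet> (K i *v x)) \<le> E \<sigma> x x"
  unfolding E_def
  by (rule member_le_sum) (auto intro!: mult_nonneg_nonneg psd less_imp_le[OF weight_pos])

lemma E_nonneg: "0 \<le> E \<sigma> x x"
  unfolding E_def by (intro sum_nonneg mult_nonneg_nonneg psd less_imp_le[OF weight_pos])

lemma invertible_A: "invertible (A \<sigma>)"
proof -
  have "x = 0" if "A \<sigma> *v x = 0" for x
  proof (rule definite)
    fix i
    have "((\<sigma> $ i)\<^sup>2 + \<epsilon>) * (x \<bullet> (K i *v x)) \<le> 0"
      using weight_le_E[of \<sigma> i x] inner_A[of x \<sigma> x] that by simp
    then show "x \<bullet> (K i *v x) = 0"
      using weight_pos[of \<sigma> i] psd[of x i] by (simp add: mult_le_0_iff)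
  qed
  then show ?thesis by (simp add: invertible_left_inverse matrix_left_invertible_ker)
qed

lemma A_u: "A \<sigma> *v u \<sigma> = f"
proof -
  have "A \<sigma> ** matrix_inv (A \<sigma>) = mat 1"
    using invertible_A[of \<sigma>] someI_ex[of "\<lambda>B. A \<sigma> ** B = mat 1 \<and> B ** A \<sigma> = mat 1"]
    unfolding invertible_def matrix_inv_def by blast
  then show ?thesis by (simp add: u_def matrix_vector_mul_assoc)
qed

text \<open>The weak form of the linear system. It holds for every \<sigma> with the same right-hand
  side, which lets solutions for different weights be compared without handling inverse
  matrices.\<close>

lemma E_u: "E \<sigma> x (u \<sigma>) = f \<bullet> x"
  by (metis inner_A A_u inner_commute)

lemma N_cauchy_schwarz: "\<bar>x \<bullet> (K i *v y)\<bar> \<le> N i x * N i y"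
  unfolding N_def
  by (rule psd_cauchy_schwarz[of "\<lambda>x y. x \<bullet> (K i *v y)"])
     (auto simp: psd sym matrix_vector_right_distrib inner_add_right matrix_vector_mult_scaleR)

lemma NE_cauchy_schwarz: "\<bar>E \<sigma> x y\<bar> \<le> NE \<sigma> x * NE \<sigma> y"
  unfolding NE_def
proof (rule psd_cauchy_schwarz[of "E \<sigma>"])
  show "E \<sigma> x (y + z) = E \<sigma> x y + E \<sigma> x z" "E \<sigma> x (c *\<^sub>R y) = c * E \<sigma> x y" for x y z c
    by (simp_all add: inner_A[symmetric] matrix_vector_right_distrib inner_add_right
        matrix_vector_mult_scaleR)
qed (rule E_sym E_nonneg)+

lemma N_nonneg [simp]: "0 \<le> N i x" and NE_nonneg [simp]: "0 \<le> NE \<sigma> x"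
  by (simp_all add: N_def NE_def psd E_nonneg)

lemma N_square: "(N i x)\<^sup>2 = x \<bullet> (K i *v x)" and NE_square: "(NE \<sigma> x)\<^sup>2 = E \<sigma> x x"
  by (simp_all add: N_def NE_def psd E_nonneg)

text \<open>Drops the \<open>\<epsilon>\<close> part of the weight; \<open>N_le_NE\<close> keeps
  only that part. Together they bound the seminorm with or without a factor
  \<open>\<bar>\<sigma> $ i\<bar>\<close>.\<close>

lemma weight_N_le_NE: "\<bar>\<sigma> $ i\<bar> * N i x \<le> NE \<sigma> x"
proof (rule power2_le_imp_le)
  have "(\<sigma> $ i)\<^sup>2 * (x \<bullet> (K i *v x)) \<le> ((\<sigma> $ i)\<^sup>2 + \<epsilon>) * (x \<bullet> (K i *v x))"
    using eps psd by (intro mult_right_mono) auto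
  then show "(\<bar>\<sigma> $ i\<bar> * N i x)\<^sup>2 \<le> (NE \<sigma> x)\<^sup>2"
    using weight_le_E[of \<sigma> i x] by (simp add: power_mult_distrib N_square NE_square)
qed simp

lemma N_le_NE: "N i x \<le> NE \<sigma> x / sqrt \<epsilon>"
proof -
  have "sqrt \<epsilon> * N i x \<le> NE \<sigma> x"
  proof (rule power2_le_imp_le)
    have "\<epsilon> * (x \<bullet> (K i *v x)) \<le> ((\<sigma> $ i)\<^sup>2 + \<epsilon>) * (x \<bullet> (K i *v x))"
      using psd by (intro mult_right_mono) auto
    then show "(sqrt \<epsilon> * N i x)\<^sup>2 \<le> (NE \<sigma> x)\<^sup>2"
      using weight_le_E[of \<sigma> i x] eps by (simp add: power_mult_distrib N_square NE_square)
  qed simp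
  then show ?thesis using eps by (simp add: field_simps)
qed

section \<open>Bounds uniform in the weights\<close>

definition M where "M = NE 0 (u 0)"

text \<open>The weights are smallest at 0, so \<open>E 0 \<le> E \<sigma>\<close> on the diagonal.
  Testing both weak forms with \<open>u \<sigma>\<close> gives the square of
  \<open>NE \<sigma> (u \<sigma>)\<close> as \<open>E 0 (u \<sigma>) (u 0)\<close>, and
  Cauchy-Schwarz for \<open>E 0\<close> finishes.\<close>

lemma NE_u_le: "NE \<sigma> (u \<sigma>) \<le> M"
proof -
  have "E 0 x x \<le> E \<sigma> x x" for x
    unfolding E_def using psd by (intro sum_mono mult_right_mono) auto
  then have le: "NE 0 (u \<sigma>) \<le> NE \<sigma> (u \<sigma>)" by (simp add: NE_def)
  have "(NE \<sigma> (u \<sigma>))\<^sup>2 = E 0 (u \<sigma>) (u 0)" by (simp add: NE_square E_u)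
  also have "\<dots> \<le> NE 0 (u \<sigma>) * M" unfolding M_def using NE_cauchy_schwarz[of 0 "u \<sigma>" "u 0"] by simp
  also have "\<dots> \<le> NE \<sigma> (u \<sigma>) * M" using le by (intro mult_right_mono) (simp_all add: M_def)
  finally have "NE \<sigma> (u \<sigma>) * NE \<sigma> (u \<sigma>) \<le> NE \<sigma> (u \<sigma>) * M" by (simp add: power2_eq_square)
  then show ?thesis by (rule le_of_mult_self_le) (simp_all add: M_def)
qed

lemma M_nonneg: "0 \<le> M" by (simp add: M_def)

lemma N_u_le: "N i (u \<sigma>) \<le> M / sqrt \<epsilon>"
  using N_le_NE[of i "u \<sigma>" \<sigma>] NE_u_le[of \<sigma>] eps by (meson divide_right_mono order_trans real_sqrt_ge_zero less_imp_le)

text \<open>Each factor \<open>\<bar>\<tau> $ i\<bar>\<close>, \<open>\<bar>\<sigma> $ i\<bar>\<close> is absorbed into the energy norm weighted by that very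
  vector, which makes the Lipschitz bound global.\<close>

lemma u_lipschitz: "NE \<sigma> (u \<sigma> - u \<tau>) \<le> 2 * M / sqrt \<epsilon> * (\<Sum>i\<in>UNIV. \<bar>\<tau> $ i - \<sigma> $ i\<bar>)"
proof -
  define w where "w = u \<sigma> - u \<tau>"
  have "E \<sigma> w w = E \<sigma> w (u \<sigma>) - E \<sigma> w (u \<tau>)"
    unfolding inner_A[symmetric] by (simp add: w_def matrix_vector_mult_diff_distrib inner_diff_right)
  \<comment> \<open>Both \<open>E \<sigma> w (u \<sigma>)\<close> and
    \<open>E \<tau> w (u \<tau>)\<close> equal \<open>f \<bullet> w\<close>, so only the difference
    of the weights remains.\<close>
  also have "\<dots> = E \<tau> w (u \<tau>) - E \<sigma> w (u \<tau>)" by (simp add: E_u)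
  also have "\<dots> = (\<Sum>i\<in>UNIV. (\<tau> $ i - \<sigma> $ i) * ((\<tau> $ i + \<sigma> $ i) * (w \<bullet> (K i *v u \<tau>))))"
    unfolding E_def sum_subtractf[symmetric]
    by (intro sum.cong refl) (simp add: power2_eq_square algebra_simps)
  also have "\<dots> \<le> (\<Sum>i\<in>UNIV. \<bar>\<tau> $ i - \<sigma> $ i\<bar> * (2 * M / sqrt \<epsilon> * NE \<sigma> w))"
  proof (rule sum_mono)
    fix i
    have "\<bar>(\<tau> $ i + \<sigma> $ i) * (w \<bullet> (K i *v u \<tau>))\<bar> \<le> (\<bar>\<tau> $ i\<bar> + \<bar>\<sigma> $ i\<bar>) * (N i w * N i (u \<tau>))"
      unfolding abs_mult using N_cauchy_schwarz[of w i "u \<tau>"] by (intro mult_mono) auto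
    also have "\<dots> = N i w * (\<bar>\<tau> $ i\<bar> * N i (u \<tau>)) + (\<bar>\<sigma> $ i\<bar> * N i w) * N i (u \<tau>)"
      by (simp add: algebra_simps)
    also have "\<dots> \<le> (NE \<sigma> w / sqrt \<epsilon>) * M + NE \<sigma> w * (M / sqrt \<epsilon>)"
      using order_trans[OF weight_N_le_NE[of \<tau> i "u \<tau>"] NE_u_le[of \<tau>]] eps
      by (intro add_mono mult_mono N_le_NE weight_N_le_NE N_u_le) (auto simp: M_nonneg)
    finally have "\<bar>(\<tau> $ i + \<sigma> $ i) * (w \<bullet> (K i *v u \<tau>))\<bar> \<le> 2 * M / sqrt \<epsilon> * NE \<sigma> w"
      by (simp add: field_simps)
    then have "\<bar>\<tau> $ i - \<sigma> $ i\<bar> * \<bar>(\<tau> $ i + \<sigma> $ i) * (w \<bullet> (K i *v u \<tau>))\<bar>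
        \<le> \<bar>\<tau> $ i - \<sigma> $ i\<bar> * (2 * M / sqrt \<epsilon> * NE \<sigma> w)"
      by (rule mult_left_mono) simp
    then show "(\<tau> $ i - \<sigma> $ i) * ((\<tau> $ i + \<sigma> $ i) * (w \<bullet> (K i *v u \<tau>)))
        \<le> \<bar>\<tau> $ i - \<sigma> $ i\<bar> * (2 * M / sqrt \<epsilon> * NE \<sigma> w)"
      unfolding abs_mult[symmetric] by (rule order_trans[OF abs_ge_self])
  qed
  also have "\<dots> = NE \<sigma> w * (2 * M / sqrt \<epsilon> * (\<Sum>i\<in>UNIV. \<bar>\<tau> $ i - \<sigma> $ i\<bar>))"
    by (simp add: sum_distrib_left sum_divide_distrib mult_ac)
  finally have "NE \<sigma> w * NE \<sigma> w \<le> NE \<sigma> w * (2 * M / sqrt \<epsilon> * (\<Sum>i\<in>UNIV. \<bar>\<tau> $ i - \<sigma> $ i\<bar>))"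
    by (simp add: NE_square[symmetric] power2_eq_square)
  moreover have "0 \<le> 2 * M / sqrt \<epsilon> * (\<Sum>i\<in>UNIV. \<bar>\<tau> $ i - \<sigma> $ i\<bar>)"
    using M_nonneg eps by (intro mult_nonneg_nonneg sum_nonneg) auto
  ultimately show ?thesis unfolding w_def[symmetric]
    by (rule le_of_mult_self_le[OF _ NE_nonneg])
qed

text \<open>The difference is split so that a bare \<open>\<sigma> $ i\<close> multiplies only terms
  containing \<open>w = u \<sigma> - u \<tau>\<close>, whose seminorm absorbs it; the quadratic term
  in \<open>u \<tau>\<close> meets just \<open>\<sigma> $ i - \<tau> $ i\<close>.\<close>

lemma grad_lipschitz: "\<exists>L>0. \<forall>\<sigma> \<tau>. norm (grad \<sigma> - grad \<tau>) \<le> L * norm (\<sigma> - \<tau>)"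
proof -
  define c where "c = M / sqrt \<epsilon>"
  have c: "0 \<le> c" using M_nonneg eps by (simp add: c_def)
  \<comment> \<open>The constants of the components are summed because the norm is estimated by the
    sum of absolute values; \<open>CARD('N)\<close> converts the sum in \<open>u_lipschitz\<close>
    back to a norm.\<close>
  define L where "L = (\<Sum>i\<in>UNIV. 2 * (\<bar>a $ i\<bar> + c\<^sup>2 + 4 * c\<^sup>2 * CARD('N)))"
  have "norm (grad \<sigma> - grad \<tau>) \<le> (L + 1) * norm (\<sigma> - \<tau>)" for \<sigma> \<tau>
  proof -
    define r where "r = norm (\<sigma> - \<tau>)"
    have comp: "\<bar>(grad \<sigma> - grad \<tau>) $ i\<bar> \<le> 2 * (\<bar>a $ i\<bar> + c\<^sup>2 + 4 * c\<^sup>2 * CARD('N)) * r" for i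
    proof -
      define w where "w = u \<sigma> - u \<tau>"
      have r: "\<bar>\<sigma> $ i - \<tau> $ i\<bar> \<le> r" using component_le_norm_cart[of "\<sigma> - \<tau>" i] by (simp add: r_def)
      have "NE \<sigma> w \<le> 2 * c * (\<Sum>i\<in>UNIV. \<bar>\<tau> $ i - \<sigma> $ i\<bar>)"
        using u_lipschitz[of \<sigma> \<tau>] by (simp add: w_def c_def)
      also have "\<dots> \<le> 2 * c * (CARD('N) * r)"
        using c sum_abs_diff_le_card_norm[of \<tau> \<sigma>] unfolding r_def by (intro mult_left_mono) auto
      finally have w: "NE \<sigma> w \<le> 2 * c * (CARD('N) * r)" .
      have Nc: "N i (u \<rho>) \<le> c" for \<rho> using N_u_le[of i \<rho>] by (simp add: c_def)
      have cs: "\<bar>w \<bullet> (K i *v u \<rho>)\<bar> * \<bar>\<sigma> $ i\<bar> \<le> (2 * c * (CARD('N) * r)) * c" for \<rho>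
      proof -
        have "\<bar>w \<bullet> (K i *v u \<rho>)\<bar> * \<bar>\<sigma> $ i\<bar> \<le> (N i w * N i (u \<rho>)) * \<bar>\<sigma> $ i\<bar>"
          by (intro mult_right_mono N_cauchy_schwarz) auto
        also have "\<dots> = (\<bar>\<sigma> $ i\<bar> * N i w) * N i (u \<rho>)" by simp
        also have "\<dots> \<le> (2 * c * (CARD('N) * r)) * c"
          using c by (intro mult_mono order_trans[OF weight_N_le_NE w] Nc) (auto simp: r_def)
        finally show ?thesis .
      qed
      have q: "\<bar>u \<tau> \<bullet> (K i *v u \<tau>)\<bar> \<le> c\<^sup>2"
        using power_mono[OF Nc[of \<tau>], of 2] psd[of "u \<tau>" i] by (simp add: N_square)
      have "u \<sigma> \<bullet> (K i *v u \<sigma>) - u \<tau> \<bullet> (K i *v u \<tau>) = w \<bullet> (K i *v u \<sigma>) + w \<bullet> (K i *v u \<tau>)"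
        using sym[of "u \<tau>" i "u \<sigma>"] by (simp add: w_def inner_diff_left)
      then have eq: "(grad \<sigma> - grad \<tau>) $ i = 2 * ((\<sigma> $ i - \<tau> $ i) * (a $ i - u \<tau> \<bullet> (K i *v u \<tau>))
          - ((w \<bullet> (K i *v u \<sigma>)) * \<sigma> $ i + (w \<bullet> (K i *v u \<tau>)) * \<sigma> $ i))"
        by (simp add: grad_def algebra_simps)
      have "\<bar>(\<sigma> $ i - \<tau> $ i) * (a $ i - u \<tau> \<bullet> (K i *v u \<tau>))\<bar> \<le> r * (\<bar>a $ i\<bar> + c\<^sup>2)"
        unfolding abs_mult using r q by (intro mult_mono) auto
      moreover have "\<bar>(w \<bullet> (K i *v u \<rho>)) * \<sigma> $ i\<bar> \<le> (2 * c * (CARD('N) * r)) * c" for \<rho>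
        using cs[of \<rho>] by (simp add: abs_mult)
      moreover have triangle: "\<bar>2 * (X - (Y + Z))\<bar> \<le> 2 * (b + (b' + b'))"
        if "\<bar>X\<bar> \<le> b" "\<bar>Y\<bar> \<le> b'" "\<bar>Z\<bar> \<le> b'" for X Y Z b b' :: real
        using that by (auto simp: abs_le_iff)
      ultimately have "\<bar>(grad \<sigma> - grad \<tau>) $ i\<bar>
          \<le> 2 * (r * (\<bar>a $ i\<bar> + c\<^sup>2) + ((2 * c * (CARD('N) * r)) * c + (2 * c * (CARD('N) * r)) * c))"
        unfolding eq by (intro triangle)
      also have "\<dots> = 2 * (\<bar>a $ i\<bar> + c\<^sup>2 + 4 * c\<^sup>2 * CARD('N)) * r"
        by (simp add: power2_eq_square algebra_simps)
      finally show ?thesis .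
    qed
    have "norm (grad \<sigma> - grad \<tau>) \<le> (\<Sum>i\<in>UNIV. \<bar>(grad \<sigma> - grad \<tau>) $ i\<bar>)" by (rule norm_le_l1_cart)
    also have "\<dots> \<le> L * r" unfolding L_def sum_distrib_right by (intro sum_mono comp)
    also have "\<dots> \<le> (L + 1) * r" by (simp add: r_def distrib_right)
    finally show ?thesis by (simp add: r_def)
  qed
  moreover have "0 < L + 1" unfolding L_def using c by (intro add_nonneg_pos sum_nonneg) auto
  ultimately show ?thesis by blast
qed

text \<open>An exact increment formula holds, with differences of squares as first factors and the
  mixed products \<open>u \<sigma> \<bullet> (K i *v u \<tau>)\<close> in the second. These need
  only be continuous at \<sigma>, which the Lipschitz bound for \<open>u\<close> provides.\<close>

lemma GDERIV_F: "GDERIV F \<sigma> :> grad \<sigma>"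
proof -
  define p where "p i \<tau> = u \<sigma> \<bullet> (K i *v u \<tau>)" for i \<tau>
  have isCont_p: "isCont (p i) \<sigma>" for i
    unfolding isCont_def
  proof (rule LIM_zero_cancel, rule Lim_null_comparison)
    let ?C = "M / sqrt \<epsilon> * ((2 * M / sqrt \<epsilon>) / sqrt \<epsilon>)"
    have "\<bar>p i \<tau> - p i \<sigma>\<bar> \<le> ?C * (\<Sum>j\<in>UNIV. \<bar>\<tau> $ j - \<sigma> $ j\<bar>)" for \<tau>
    proof -
      have "\<bar>p i \<tau> - p i \<sigma>\<bar> = \<bar>u \<sigma> \<bullet> (K i *v (u \<sigma> - u \<tau>))\<bar>"
        by (simp add: p_def matrix_vector_mult_diff_distrib inner_diff_right abs_minus_commute)
      also have "\<dots> \<le> N i (u \<sigma>) * N i (u \<sigma> - u \<tau>)" by (rule N_cauchy_schwarz)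
      also have "\<dots> \<le> (M / sqrt \<epsilon>) * ((2 * M / sqrt \<epsilon> * (\<Sum>j\<in>UNIV. \<bar>\<tau> $ j - \<sigma> $ j\<bar>)) / sqrt \<epsilon>)"
        using eps M_nonneg
        by (intro mult_mono N_u_le order_trans[OF N_le_NE[of _ _ \<sigma>]] divide_right_mono u_lipschitz) auto
      finally show ?thesis by simp
    qed
    then show "\<forall>\<^sub>F \<tau> in at \<sigma>. norm (p i \<tau> - p i \<sigma>) \<le> ?C * (\<Sum>j\<in>UNIV. \<bar>\<tau> $ j - \<sigma> $ j\<bar>)" by simp
    have "((\<lambda>\<tau>. ?C * (\<Sum>j\<in>UNIV. \<bar>\<tau> $ j - \<sigma> $ j\<bar>)) \<longlongrightarrow> ?C * (\<Sum>j\<in>UNIV. \<bar>\<sigma> $ j - \<sigma> $ j\<bar>)) (at \<sigma>)"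
      by (intro tendsto_intros)
    then show "((\<lambda>\<tau>. ?C * (\<Sum>j\<in>UNIV. \<bar>\<tau> $ j - \<sigma> $ j\<bar>)) \<longlongrightarrow> 0) (at \<sigma>)" by simp
  qed
  have F_eq: "F \<tau> = F \<sigma> + (\<Sum>i\<in>UNIV. ((\<tau> $ i)\<^sup>2 - (\<sigma> $ i)\<^sup>2) * (a $ i - p i \<tau>))" for \<tau>
  proof -
    \<comment> \<open>Each load term is obtained by testing the weak form for one parameter with the
      solution for the other, so both are energies of the same pair.\<close>
    have "f \<bullet> u \<tau> - f \<bullet> u \<sigma> = E \<sigma> (u \<sigma>) (u \<tau>) - E \<tau> (u \<sigma>) (u \<tau>)"
      using E_u[of \<sigma> "u \<tau>"] E_u[of \<tau> "u \<sigma>"] E_sym[of \<sigma> "u \<tau>" "u \<sigma>"] by simp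
    also have "\<dots> = (\<Sum>i\<in>UNIV. ((\<tau> $ i)\<^sup>2 - (\<sigma> $ i)\<^sup>2) * (- p i \<tau>))"
      unfolding E_def sum_subtractf[symmetric] p_def by (intro sum.cong refl) (simp add: algebra_simps)
    finally have 1: "f \<bullet> u \<tau> = f \<bullet> u \<sigma> + (\<Sum>i\<in>UNIV. ((\<tau> $ i)\<^sup>2 - (\<sigma> $ i)\<^sup>2) * (- p i \<tau>))" by simp
    have 2: "(\<chi> i. (\<tau> $ i)\<^sup>2) \<bullet> a = (\<chi> i. (\<sigma> $ i)\<^sup>2) \<bullet> a + (\<Sum>i\<in>UNIV. ((\<tau> $ i)\<^sup>2 - (\<sigma> $ i)\<^sup>2) * a $ i)"
      by (simp add: inner_vec_def left_diff_distrib sum_subtractf)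
    show ?thesis
      unfolding F_def 1 2 by (simp add: right_diff_distrib sum_subtractf sum_negf)
  qed
  have "((\<lambda>\<tau>. F \<sigma> + (\<Sum>i\<in>UNIV. ((\<tau> $ i)\<^sup>2 - (\<sigma> $ i)\<^sup>2) * (a $ i - p i \<tau>))) has_derivative
      (\<lambda>h. 0 + (\<Sum>i\<in>UNIV. (2 * \<sigma> $ i * h $ i) * (a $ i - p i \<sigma>)))) (at \<sigma>)"
  proof (intro has_derivative_add has_derivative_const has_derivative_sum
      has_derivative_mult_increment[where k = "\<lambda>\<tau>. (\<tau> $ _)\<^sup>2"] isCont_diff isCont_p continuous_const)
    fix i
    have "((\<lambda>\<tau>. \<tau> $ i) has_derivative (\<lambda>h. h $ i)) (at \<sigma>)"
      by (rule bounded_linear_imp_has_derivative[OF bounded_linear_vec_nth])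
    from has_derivative_power[OF this, of 2]
    show "((\<lambda>\<tau>. (\<tau> $ i)\<^sup>2) has_derivative (\<lambda>h. 2 * \<sigma> $ i * h $ i)) (at \<sigma>)"
      by (simp add: mult_ac)
  qed
  moreover have "0 + (\<Sum>i\<in>UNIV. (2 * \<sigma> $ i * h $ i) * (a $ i - p i \<sigma>)) = h \<bullet> grad \<sigma>" for h
    by (simp add: inner_vec_def grad_def p_def mult_ac)
  ultimately show ?thesis unfolding gderiv_def F_eq[symmetric] by (simp add: F_eq[symmetric])
qed

text \<open>Gradients are unique, so the existential \<open>D\<close> must be \<open>grad\<close>;
  flows thus become solutions of an equation with a globally Lipschitz right-hand side.\<close>

lemma classical_gradient_flow_F_iff:
  "classical_gradient_flow F \<sigma>0 \<sigma> \<longleftrightarrow> continuous_on {0..} \<sigma> \<and> \<sigma> 0 = \<sigma>0 \<and>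
     (\<forall>t>0. (\<sigma> has_vector_derivative - grad (\<sigma> t)) (at t))"
proof -
  have "D = grad x" if "GDERIV F x :> D" for x D
  proof -
    have "(\<lambda>h. h \<bullet> D) = (\<lambda>h. h \<bullet> grad x)"
      using that GDERIV_F[of x] unfolding gderiv_def by (rule has_derivative_unique)
    then have "\<forall>h. h \<bullet> D = h \<bullet> grad x" by (simp add: fun_eq_iff)
    then show ?thesis by (simp only: vector_eq_ldot)
  qed
  then show ?thesis unfolding classical_gradient_flow_def using GDERIV_F by metis
qed

section \<open>Analyticity along the flow and well-posedness\<close>

lemma analytic_flow:
  assumes "continuous_on {0..} \<sigma>"
    and der: "\<And>t. t > 0 \<Longrightarrow> (\<sigma> has_vector_derivative - grad (\<sigma> t)) (at t)"
  shows "\<sigma> real_analytic_on {0<..}"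
proof (rule real_analytic_on_vecI)
  fix i and t0 :: real assume "t0 \<in> {0<..}"
  then have t0: "0 < t0" by simp
  define y where "y j t = \<sigma> t $ j" for j t
  define dt where "dt t = det (A (\<sigma> t))" for t
  define \<rho> where "\<rho> t = inverse (dt t)" for t
  \<comment> \<open>The entries of \<open>u\<close> need not be adjoined: Cramer's rule makes them
    polynomials in these generators.\<close>
  define S where "S = insert \<rho> (range y)"
  define I where "I = ({0<..} :: real set)"
  have dt0: "dt t \<noteq> 0" for t
    using invertible_A[of "\<sigma> t"] by (simp add: dt_def invertible_det_nz)
  have yS: "poly_in S (y j)" and \<rho>S: "poly_in S \<rho>" for j
    by (auto simp: S_def intro: poly_in_gen)
  have A_entry: "A (\<sigma> t) $ p $ q = (\<Sum>j\<in>UNIV. ((y j t)\<^sup>2 + \<epsilon>) * K j $ p $ q)" for t p q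
    by (simp add: A_def y_def)
  have A_in: "poly_in X (\<lambda>t. A (\<sigma> t) $ p $ q)" if "\<And>j. poly_in X (y j)" for X p q
    unfolding A_entry by (intro poly_in_intros that)
  have u_eq: "u (\<sigma> t) $ k = det (\<chi> p q. if q = k then f $ p else A (\<sigma> t) $ p $ q) * \<rho> t" for t k
    using cramer[of "A (\<sigma> t)" "u (\<sigma> t)" f] A_u[of "\<sigma> t"] dt0[of t]
    by (simp add: dt_def \<rho>_def divide_inverse)
  have u_in: "poly_in S (\<lambda>t. u (\<sigma> t) $ k)" for k
    unfolding u_eq
  proof (intro poly_in_mult \<rho>S poly_in_det)
    fix p q
    show "poly_in S (\<lambda>t. (\<chi> p q. if q = k then f $ p else A (\<sigma> t) $ p $ q) $ p $ q)"
      by (cases "q = k") (auto intro: poly_in_const A_in yS)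
  qed
  define y' where "y' j t = - grad (\<sigma> t) $ j" for j t
  have y'_in: "poly_in S (y' j)" for j
  proof -
    have "y' j = (\<lambda>t. (- 2) * y j t * (a $ j - (\<Sum>p\<in>UNIV. u (\<sigma> t) $ p * (\<Sum>q\<in>UNIV. K j $ p $ q * u (\<sigma> t) $ q))))"
      by (simp add: fun_eq_iff y'_def y_def grad_def inner_vec_def matrix_vector_mult_def)
    then show ?thesis by (simp only:) (intro poly_in_intros yS u_in)
  qed
  have y_der: "(y j has_real_derivative y' j t) (at t)" if "t \<in> I" for j t
    using bounded_linear.has_vector_derivative[OF bounded_linear_vec_nth der, of t j] that
    by (simp add: y_def[abs_def] y'_def I_def has_real_derivative_iff_has_vector_derivative)
  \<comment> \<open>The determinant is expressed in the coordinates alone, so it can be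
    differentiated before the derivative of \<open>\<rho>\<close> is known.\<close>
  have "poly_in (range y) dt" unfolding dt_def by (intro poly_in_det A_in poly_in_gen rangeI)
  then obtain dt' where dt': "\<forall>t\<in>I. (dt has_real_derivative dt' t) (at t)" "poly_in S dt'"
  proof -
    have "\<exists>x'. (\<forall>t\<in>I. (x has_real_derivative x' t) (at t)) \<and> poly_in S x'" if "x \<in> range y" for x
      using that y_der y'_in by blast
    then have "\<exists>f'. (\<forall>t\<in>I. (dt has_real_derivative f' t) (at t)) \<and> poly_in S f'"
      by (intro poly_in_has_derivative[OF \<open>poly_in (range y) dt\<close>]) (auto simp: S_def)
    then show thesis using that by blast
  qed
  have \<rho>_der: "(\<rho> has_real_derivative - (dt' t * (\<rho> t)\<^sup>2)) (at t)" if "t \<in> I" for t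
    using DERIV_inverse_fun[OF dt'(1)[rule_format, OF that] dt0]
    unfolding \<rho>_def[abs_def] by (simp add: power_inverse numeral_2_eq_2)
  have S_der: "\<exists>x'. (\<forall>t\<in>I. (x has_real_derivative x' t) (at t)) \<and> poly_in S x'" if "x \<in> S" for x
  proof (cases "x = \<rho>")
    case True
    have "poly_in S (\<lambda>t. (- 1) * (dt' t * (\<rho> t)\<^sup>2))" by (intro poly_in_intros dt'(2) \<rho>S)
    then show ?thesis
      using True \<rho>_der by (intro exI[of _ "\<lambda>t. - (dt' t * (\<rho> t)\<^sup>2)"]) simp
  next
    case False
    then show ?thesis using that y_der y'_in by (auto simp: S_def)
  qed
  \<comment> \<open>The radius \<open>t0 / 2\<close> keeps the closed interval inside the positive
    times, where compactness bounds each of the finitely many generators.\<close>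
  have "\<exists>R. \<forall>x\<in>S. \<forall>t. \<bar>t - t0\<bar> < t0 / 2 \<longrightarrow> \<bar>x t\<bar> \<le> R"
  proof -
    have "\<exists>b. \<forall>t. \<bar>t - t0\<bar> < t0 / 2 \<longrightarrow> \<bar>x t\<bar> \<le> b" if xS: "x \<in> S" for x
    proof -
      obtain x' where "\<forall>t\<in>I. (x has_real_derivative x' t) (at t)" using S_der[OF xS] by blast
      then have "continuous_on {t0 / 2..3 * t0 / 2} x"
        using t0 by (intro continuous_at_imp_continuous_on ballI DERIV_isCont) (auto simp: I_def)
      then have "bounded (x ` {t0 / 2..3 * t0 / 2})"
        by (intro compact_imp_bounded compact_continuous_image) auto
      then obtain b where "\<forall>t\<in>{t0 / 2..3 * t0 / 2}. \<bar>x t\<bar> \<le> b" by (auto simp: bounded_iff)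
      moreover have "t \<in> {t0 / 2..3 * t0 / 2}" if "\<bar>t - t0\<bar> < t0 / 2" for t
        using that unfolding atLeastAtMost_iff abs_less_iff by (intro conjI; linarith)
      ultimately show ?thesis by blast
    qed
    then obtain b where b: "\<And>x t. x \<in> S \<Longrightarrow> \<bar>t - t0\<bar> < t0 / 2 \<Longrightarrow> \<bar>x t\<bar> \<le> b x" by metis
    have "\<bar>x t\<bar> \<le> Max (b ` S)" if "x \<in> S" "\<bar>t - t0\<bar> < t0 / 2" for x t
      using b[OF that] that(1) by (intro order_trans[OF _ Max_ge]) (auto simp: S_def)
    then show ?thesis by blast
  qed
  then obtain R where R: "\<And>x t. x \<in> S \<Longrightarrow> \<bar>t - t0\<bar> < t0 / 2 \<Longrightarrow> \<bar>x t\<bar> \<le> R" by blast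
  have "\<exists>a. \<exists>r>0. \<forall>s. \<bar>s - t0\<bar> < r \<longrightarrow> (\<lambda>k. (s - t0) ^ k * a k) sums y i s"
  proof (rule power_series_of_poly_closed[of S "t0 / 2" t0 R])
    fix x assume "x \<in> S"
    then obtain x' where x': "\<forall>t\<in>I. (x has_real_derivative x' t) (at t)" "poly_in S x'"
      using S_der by blast
    moreover have "t \<in> I" if "\<bar>t - t0\<bar> < t0 / 2" for t
      using that t0 unfolding I_def greaterThan_iff abs_less_iff by linarith
    ultimately show "\<exists>x'. (\<forall>t. \<bar>t - t0\<bar> < t0 / 2 \<longrightarrow> (x has_real_derivative x' t) (at t)) \<and> poly_in S x'"
      by blast
  qed (use t0 R in \<open>auto simp: S_def\<close>)
  then show "\<exists>a. \<exists>r>0. \<forall>s. \<bar>s - t0\<bar> < r \<longrightarrow> (\<lambda>k. (s - t0) ^ k * a k) sums (\<sigma> s $ i)"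
    by (simp add: y_def)
qed

lemma gradient_flow_well_posed:
  "\<exists>\<sigma>. classical_gradient_flow F \<sigma>0 \<sigma> \<and> \<sigma> real_analytic_on {0<..} \<and>
     (\<forall>\<tau>. classical_gradient_flow F \<sigma>0 \<tau> \<longrightarrow> (\<forall>t\<ge>0. \<tau> t = \<sigma> t))"
proof -
  define G where "G \<sigma> = - grad \<sigma>" for \<sigma>
  obtain L where "0 < L" and lip: "\<And>\<sigma> \<tau>. norm (grad \<sigma> - grad \<tau>) \<le> L * norm (\<sigma> - \<tau>)"
    using grad_lipschitz by blast
  have L: "norm (G \<sigma> - G \<tau>) \<le> L * norm (\<sigma> - \<tau>)" for \<sigma> \<tau>
    using lip[of \<sigma> \<tau>] by (simp add: G_def norm_minus_commute)
  obtain \<sigma> where \<sigma>: "continuous_on {0..} \<sigma>" "\<sigma> 0 = \<sigma>0"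
    "\<And>t. t > 0 \<Longrightarrow> (\<sigma> has_vector_derivative G (\<sigma> t)) (at t)"
    using lipschitz_ode_exists[OF L \<open>0 < L\<close>, of \<sigma>0] by blast
  show ?thesis
  proof (intro exI conjI allI impI)
    show "classical_gradient_flow F \<sigma>0 \<sigma>"
      using \<sigma> by (simp add: classical_gradient_flow_F_iff G_def)
    show "\<sigma> real_analytic_on {0<..}"
      using \<sigma> by (intro analytic_flow) (simp_all add: G_def)
    fix \<tau> and t :: real
    assume "classical_gradient_flow F \<sigma>0 \<tau>" "0 \<le> t"
    then have \<tau>: "continuous_on {0..} \<tau>" "\<tau> 0 = \<sigma> 0"
      "\<And>t. t > 0 \<Longrightarrow> (\<tau> has_vector_derivative G (\<tau> t)) (at t)"
      by (simp_all add: classical_gradient_flow_F_iff G_def \<sigma>(2))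
    show "\<tau> t = \<sigma> t"
      by (rule gronwall_unique[OF L \<tau>(1) \<sigma>(1) \<tau>(3) \<sigma>(3) \<tau>(2) \<open>0 \<le> t\<close>])
  qed
qed

end

subsection \<open>Stiffness matrices of finite elements\<close>

lemma unit_cube_eq_box: "unit_cube = box 0 (1 :: real ^ 'd)"
  by (auto simp: unit_cube_def mem_box_cart)

text \<open>These facts reduce integrals over simplices to their interiors. The interior lies in the
  open cube because a convex open set is the interior of its closure.\<close>

lemma triangulation_of_unit_cube_simplex:
  fixes S :: "(real ^ 'd) set"
  assumes "triangulation_of unit_cube \<T>" "S \<in> \<T>"
  shows "compact S" "interior S \<subseteq> unit_cube" "interior S \<noteq> {}" "negligible (S - interior S)"
proof -
  have S: "int CARD('d) simplex S" "S \<subseteq> closure unit_cube"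
    using assms by (auto simp: triangulation_of_def)
  show "compact S" using S(1) simplex_imp_polytope polytope_imp_compact by blast
  have "convex S" using S(1) by (auto simp: simplex_def)
  show "interior S \<subseteq> unit_cube"
    using interior_mono[OF S(2)]
    by (simp add: unit_cube_eq_box convex_interior_closure interior_open open_box)
  have "affine hull S = UNIV"
    using aff_dim_simplex[OF S(1)] aff_dim_eq_full[of S] by simp
  then have "rel_interior S = interior S" by (rule rel_interior_interior)
  moreover have "S \<noteq> {}" using aff_dim_simplex[OF S(1)] by auto
  ultimately show "interior S \<noteq> {}" using rel_interior_eq_empty[OF \<open>convex S\<close>] by simp
  have "S - interior S \<subseteq> frontier S" unfolding frontier_def using closure_subset by auto
  then show "negligible (S - interior S)"
    using negligible_convex_frontier[OF \<open>convex S\<close>] negligible_subset by blast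
qed

lemma gradient_eqI: "GDERIV g x :> D \<Longrightarrow> gradient g x = D"
  unfolding gradient_def
proof (rule the_equality)
  fix D' assume "GDERIV g x :> D" "GDERIV g x :> D'"
  then have "(\<lambda>h. h \<bullet> D') = (\<lambda>h. h \<bullet> D)"
    unfolding gderiv_def using has_derivative_unique by blast
  then have "\<forall>h. h \<bullet> D' = h \<bullet> D" by (simp add: fun_eq_iff)
  then show "D' = D" by (simp only: vector_eq_ldot)
qed

lemma gradient_affine_on_open:
  assumes "open U" "x \<in> U" "\<And>z. z \<in> U \<Longrightarrow> g z = b \<bullet> z + c"
  shows "gradient g x = b"
proof (rule gradient_eqI)
  have "((\<lambda>z. b \<bullet> z + c) has_derivative (\<lambda>h. h \<bullet> b)) (at x)"
    by (auto intro!: derivative_eq_intros simp: inner_commute)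
  then show "GDERIV g x :> b"
    unfolding gderiv_def
    by (rule has_derivative_transform_within_open[OF _ assms(1,2)]) (simp add: assms(3))
qed

lemma inner_double_sum:
  "(\<Sum>p\<in>P. x p *\<^sub>R G p) \<bullet> (\<Sum>q\<in>Q. y q *\<^sub>R H q) = (\<Sum>p\<in>P. \<Sum>q\<in>Q. x p * y q * (G p \<bullet> H q))"
  unfolding inner_sum_left by (simp add: inner_sum_right sum_distrib_left mult_ac)

text \<open>\<open>\<S>\<close> is the fine mesh carrying the basis and \<open>T\<close> lists the
  coarse simplices carrying the weights; \<open>covered\<close> and \<open>refined\<close> pass
  between the two.\<close>

locale fe_basis =
  fixes \<S> :: "(real ^ 'd) set set" and T :: "'N::finite \<Rightarrow> (real ^ 'd) set"
    and \<phi> :: "'m::finite \<Rightarrow> real ^ 'd \<Rightarrow> real"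
  assumes triang: "triangulation_of unit_cube \<S>"
    and covered: "\<And>S. S \<in> \<S> \<Longrightarrow> \<exists>i. S \<subseteq> T i"
    and refined: "\<And>i. \<Union>{S \<in> \<S>. S \<subseteq> T i} = T i"
    and basis: "basis_on unit_cube (fe_space unit_cube \<S>) \<phi>"
begin

section \<open>Piecewise affine functions and their Dirichlet form\<close>

lemma finite_fine: "finite \<S>"
  using triang by (simp add: triangulation_of_def triangulation_def)

lemmas fine = triangulation_of_unit_cube_simplex[OF triang]

lemma phi_fe: "\<phi> p \<in> fe_space unit_cube \<S>"
  using basis by (simp add: basis_on_def)

lemma phi_affine: "\<exists>b c. \<forall>p. \<forall>S\<in>\<S>. \<forall>x\<in>S \<inter> unit_cube. \<phi> p x = b p S \<bullet> x + c p S"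
proof -
  have "\<forall>p. \<forall>S\<in>\<S>. \<exists>b c. \<forall>x\<in>S \<inter> unit_cube. \<phi> p x = b \<bullet> x + c"
    using phi_fe by (simp add: fe_space_def)
  then show ?thesis by metis
qed

text \<open>Chosen once for all \<open>p\<close> and \<open>S\<close>, since membership in the
  finite element space only asserts existence; \<open>offset\<close> is then chosen to
  match.\<close>

definition slope where
  "slope = (SOME b. \<exists>c. \<forall>p. \<forall>S\<in>\<S>. \<forall>x\<in>S \<inter> unit_cube. \<phi> p x = b p S \<bullet> x + c p S)"

definition offset where
  "offset = (SOME c. \<forall>p. \<forall>S\<in>\<S>. \<forall>x\<in>S \<inter> unit_cube. \<phi> p x = slope p S \<bullet> x + c p S)"

lemma phi_eq: "S \<in> \<S> \<Longrightarrow> x \<in> S \<Longrightarrow> x \<in> unit_cube \<Longrightarrow> \<phi> p x = slope p S \<bullet> x + offset p S"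
  using someI_ex[OF someI_ex[OF phi_affine, folded slope_def], folded offset_def] by blast

lemma gradient_phi: "S \<in> \<S> \<Longrightarrow> x \<in> interior S \<Longrightarrow> gradient (\<phi> p) x = slope p S"
  by (rule gradient_affine_on_open[OF open_interior])
     (use phi_eq fine(2) interior_subset in blast)+

text \<open>On each fine simplex the integrand is constant off a null set; on the boundary faces
  \<open>gradient\<close> may be unspecified.\<close>

lemma integrable_gradients:
  "(\<lambda>x. gradient (\<phi> p) x \<bullet> gradient (\<phi> q) x) absolutely_integrable_on T i"
proof -
  have "(\<lambda>x. gradient (\<phi> p) x \<bullet> gradient (\<phi> q) x) absolutely_integrable_on (\<Union>S\<in>{S \<in> \<S>. S \<subseteq> T i}. S)"
  proof (rule set_integrable_UN)
    fix S assume "S \<in> {S \<in> \<S>. S \<subseteq> T i}"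
    then have S: "S \<in> \<S>" by simp
    then have meas: "S \<in> lmeasurable" using fine(1) lmeasurable_compact by blast
    then show "S \<in> sets lebesgue" by (rule fmeasurableD)
    have "(\<lambda>x. slope p S \<bullet> slope q S) absolutely_integrable_on S"
      using meas by (rule absolutely_integrable_on_const)
    then show "(\<lambda>x. gradient (\<phi> p) x \<bullet> gradient (\<phi> q) x) absolutely_integrable_on S"
      by (rule absolutely_integrable_spike[OF _ fine(4)[OF S]]) (simp add: gradient_phi[OF S])
  qed (use finite_fine in auto)
  then show ?thesis using refined[of i] by simp
qed

text \<open>As an integral of inner products of gradients, the form is visibly symmetric and
  positive semidefinite.\<close>

lemma local_stiffness_form:
  "x \<bullet> (local_stiffness \<phi> (T i) *v y)
     = integral (T i) (\<lambda>z. (\<Sum>p\<in>UNIV. x $ p *\<^sub>R gradient (\<phi> p) z) \<bullet> (\<Sum>q\<in>UNIV. y $ q *\<^sub>R gradient (\<phi> q) z))"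
proof -
  define g where "g p q z = gradient (\<phi> p) z \<bullet> gradient (\<phi> q) z" for p q z
  have int: "g p q integrable_on T i" for p q
    using set_lebesgue_integral_eq_integral(1)[OF integrable_gradients] by (simp add: g_def[abs_def])
  have "local_stiffness \<phi> (T i) $ p $ q = integral (T i) (g p q)" for p q
    using set_lebesgue_integral_eq_integral(2)[OF integrable_gradients]
    by (simp add: local_stiffness_def g_def[abs_def])
  then have "x \<bullet> (local_stiffness \<phi> (T i) *v y)
      = (\<Sum>p\<in>UNIV. \<Sum>q\<in>UNIV. integral (T i) (\<lambda>z. x $ p * y $ q * g p q z))"
    by (simp add: inner_vec_def matrix_vector_mult_def sum_distrib_left mult_ac)
  also have "\<dots> = integral (T i) (\<lambda>z. \<Sum>p\<in>UNIV. \<Sum>q\<in>UNIV. x $ p * y $ q * g p q z)"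
    by (simp add: integral_sum integrable_sum integrable_on_mult_right int)
  also have "(\<lambda>z. \<Sum>p\<in>UNIV. \<Sum>q\<in>UNIV. x $ p * y $ q * g p q z)
      = (\<lambda>z. (\<Sum>p\<in>UNIV. x $ p *\<^sub>R gradient (\<phi> p) z) \<bullet> (\<Sum>q\<in>UNIV. y $ q *\<^sub>R gradient (\<phi> q) z))"
    unfolding g_def inner_double_sum ..
  finally show ?thesis .
qed

lemma integrable_form:
  "(\<lambda>z. (\<Sum>p\<in>UNIV. x $ p *\<^sub>R gradient (\<phi> p) z) \<bullet> (\<Sum>q\<in>UNIV. y $ q *\<^sub>R gradient (\<phi> q) z)) integrable_on T i"
  unfolding inner_double_sum
  by (intro integrable_sum integrable_on_mult_right finite
      set_lebesgue_integral_eq_integral(1)[OF integrable_gradients])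

text \<open>Continuity on the open cube alone gives no integrability, but each affine piece is
  continuous on the closed cube.\<close>

lemma integrable_phi: "\<phi> p absolutely_integrable_on unit_cube"
proof -
  have "\<phi> p absolutely_integrable_on (\<Union>S\<in>\<S>. S \<inter> unit_cube)"
  proof (rule set_integrable_UN[OF finite_fine])
    fix S assume S: "S \<in> \<S>"
    have "S \<in> sets lebesgue" using fine(1)[OF S] by (intro fmeasurableD lmeasurable_compact)
    moreover have "(unit_cube :: (real ^ 'd) set) \<in> sets lebesgue"
      by (simp add: unit_cube_eq_box)
    ultimately show meas: "S \<inter> unit_cube \<in> sets lebesgue" by (rule sets.Int)
    have "(\<lambda>x. slope p S \<bullet> x + offset p S) absolutely_integrable_on cbox 0 1"
      by (intro absolutely_integrable_continuous continuous_intros)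
    then have "(\<lambda>x. slope p S \<bullet> x + offset p S) absolutely_integrable_on S \<inter> unit_cube"
      using meas box_subset_cbox by (rule_tac set_integrable_subset) (auto simp: unit_cube_eq_box)
    then show "\<phi> p absolutely_integrable_on S \<inter> unit_cube"
      by (rule absolutely_integrable_spike[OF _ negligible_empty]) (simp add: phi_eq[OF S])
  qed
  moreover have "(\<Union>S\<in>\<S>. S \<inter> unit_cube) = unit_cube"
    using triang closure_subset[of unit_cube] by (auto simp: triangulation_of_def)
  ultimately show ?thesis by simp
qed

lemma stiffness_kernel:
  assumes zero: "\<And>i. x \<bullet> (local_stiffness \<phi> (T i) *v x) = 0"
  shows "x = 0"
proof -
  \<comment> \<open>The energy on \<open>T i\<close> dominates that on the interior of
    \<open>S\<close>, where the integrand is the constant \<open>v \<bullet> v\<close>; positive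
    volume forces \<open>v = 0\<close>.\<close>
  have slope0: "(\<Sum>p\<in>UNIV. x $ p *\<^sub>R slope p S) = 0" if S: "S \<in> \<S>" for S
  proof -
    define G where "G z = (\<Sum>p\<in>UNIV. x $ p *\<^sub>R gradient (\<phi> p) z)" for z
    define v where "v = (\<Sum>p\<in>UNIV. x $ p *\<^sub>R slope p S)"
    have Gv: "G z = v" if "z \<in> interior S" for z
      using that S by (simp add: G_def v_def gradient_phi)
    obtain i where i: "S \<subseteq> T i" using covered[OF S] by blast
    have lm: "interior S \<in> lmeasurable"
      using compact_imp_bounded[OF fine(1)[OF S]] by (simp add: bounded_interior lmeasurable_open)
    have int: "(\<lambda>z. G z \<bullet> G z) integrable_on interior S"
    proof (rule integrable_spike[OF _ negligible_empty])
      show "(\<lambda>z. v \<bullet> v) integrable_on interior S"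
        using absolutely_integrable_on_const[OF lm] set_lebesgue_integral_eq_integral(1) by blast
    qed (simp add: Gv)
    have "integral (interior S) (\<lambda>z. G z \<bullet> G z) = integral (interior S) (\<lambda>z. (v \<bullet> v) * 1)"
      by (rule integral_cong) (simp add: Gv)
    also have "\<dots> = (v \<bullet> v) * measure lebesgue (interior S)"
      by (simp only: integral_mult_right lmeasure_integral[OF lm])
    finally have "(v \<bullet> v) * measure lebesgue (interior S) = integral (interior S) (\<lambda>z. G z \<bullet> G z)" ..
    also have "\<dots> \<le> integral (T i) (\<lambda>z. G z \<bullet> G z)"
    proof (rule integral_subset_le[OF _ int])
      show "interior S \<subseteq> T i" using i interior_subset by blast
      show "(\<lambda>z. G z \<bullet> G z) integrable_on T i" unfolding G_def by (rule integrable_form)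
    qed auto
    also have "\<dots> = 0" using zero[of i] unfolding local_stiffness_form G_def .
    finally have "(v \<bullet> v) * measure lebesgue (interior S) \<le> 0" .
    moreover have "0 < measure lebesgue (interior S)"
      using open_not_negligible[OF open_interior fine(3)[OF S]] lm
      by (auto simp: negligible_iff_measure zero_less_measure_iff)
    ultimately have "v \<bullet> v \<le> 0" by (simp add: mult_le_0_iff)
    then have "v = 0" by (metis inner_ge_zero inner_eq_zero_iff order_antisym)
    then show ?thesis by (simp add: v_def)
  qed
  define g where "g z = (\<Sum>p\<in>UNIV. x $ p * \<phi> p z)" for z
  have g_const: "g z = (\<Sum>p\<in>UNIV. x $ p * offset p S)" if "S \<in> \<S>" "z \<in> S" "z \<in> unit_cube" for z S
  proof -
    have "g z = (\<Sum>p\<in>UNIV. x $ p *\<^sub>R slope p S) \<bullet> z + (\<Sum>p\<in>UNIV. x $ p * offset p S)"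
      using that by (simp add: g_def phi_eq distrib_left sum.distrib inner_sum_left)
    then show ?thesis using slope0[OF that(1)] by simp
  qed
  \<comment> \<open>\<open>g\<close> takes one value per simplex, hence finitely many; continuity
    and connectedness then replace any walk through adjacent simplices.\<close>
  have "g constant_on unit_cube"
  proof (rule continuous_finite_range_constant)
    show "connected (unit_cube :: (real ^ 'd) set)"
      by (simp add: unit_cube_eq_box convex_connected)
    show "continuous_on unit_cube g"
      unfolding g_def using phi_fe by (intro continuous_intros) (auto simp: fe_space_def)
    have "g ` unit_cube \<subseteq> (\<lambda>S. \<Sum>p\<in>UNIV. x $ p * offset p S) ` \<S>"
    proof (rule image_subsetI)
      fix z :: "real ^ 'd" assume "z \<in> unit_cube"
      moreover from this have "z \<in> \<Union>\<S>"
        using triang closure_subset[of unit_cube] by (auto simp: triangulation_of_def)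
      then obtain S where "S \<in> \<S>" "z \<in> S" by blast
      ultimately show "g z \<in> (\<lambda>S. \<Sum>p\<in>UNIV. x $ p * offset p S) ` \<S>" using g_const by blast
    qed
    then show "finite (g ` unit_cube)" using finite_fine finite_subset by blast
  qed
  then obtain k where k: "\<And>z. z \<in> unit_cube \<Longrightarrow> g z = k" by (auto simp: constant_on_def)
  have int0: "integral unit_cube (\<phi> p) = 0" for p
    using phi_fe[of p] set_lebesgue_integral_eq_integral(2)[OF integrable_phi, of p]
    by (simp add: fe_space_def)
  have "integral unit_cube g = (\<Sum>p\<in>UNIV. x $ p * integral unit_cube (\<phi> p))"
    unfolding g_def
    by (simp add: integral_sum integrable_on_mult_right set_lebesgue_integral_eq_integral(1)[OF integrable_phi])
  then have "0 = integral unit_cube g" by (simp add: int0)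
  also have "\<dots> = integral unit_cube (\<lambda>z :: real ^ 'd. k * 1)" by (rule integral_cong) (simp add: k)
  also have "\<dots> = k * measure lebesgue (unit_cube :: (real ^ 'd) set)"
    by (simp only: integral_mult_right lmeasure_integral unit_cube_eq_box lmeasurable_box)
  finally have "k * measure lebesgue (unit_cube :: (real ^ 'd) set) = 0" ..
  moreover have "measure lebesgue (unit_cube :: (real ^ 'd) set) > 0"
  proof -
    have "(\<chi> i. 1 / 2) \<in> (unit_cube :: (real ^ 'd) set)" by (simp add: unit_cube_def)
    then have "\<not> negligible (unit_cube :: (real ^ 'd) set)"
      unfolding unit_cube_eq_box by (intro open_not_negligible open_box) blast
    then show ?thesis
      by (simp add: unit_cube_eq_box negligible_iff_measure zero_less_measure_iff)
  qed
  ultimately have "k = 0" by simp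
  \<comment> \<open>Up to here only the function vanishes; linear independence of the basis
    transfers this to the coefficients.\<close>
  then have "\<forall>z\<in>unit_cube. (\<Sum>p\<in>UNIV. x $ p * \<phi> p z) = 0" using k by (simp add: g_def)
  then have "\<forall>p. x $ p = 0" using basis unfolding basis_on_def by blast
  then show ?thesis by (simp add: vec_eq_iff)
qed

end

theorem theorem4p2:
  fixes f :: "real ^ 'd \<Rightarrow> real"
    and \<T> :: "nat \<Rightarrow> (real ^ 'd) set set"
    and \<delta> :: "nat \<Rightarrow> real"
    and n :: nat
    and T :: "'N::finite \<Rightarrow> (real ^ 'd) set"
    and \<phi> :: "'m::finite \<Rightarrow> real ^ 'd \<Rightarrow> real"
    and \<sigma>0 :: "real ^ 'N"
  assumes "L_infinity_on unit_cube f"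
    and "(LINT x:unit_cube|lebesgue. f x) = 0"
    and "convex hull (ess_support_on unit_cube f) \<subset>\<subset> unit_cube"
    and "\<And>k. triangulation_of unit_cube (\<T> k)"
    and "\<And>k. uniform_refinement (\<T> k) (\<T> (Suc k))"
    and "decseq \<delta>" and "\<And>k. 0 < \<delta> k" and "\<delta> \<longlonglongrightarrow> 0"
    and "bij_betw T UNIV (\<T> n)"
    and "basis_on unit_cube (fe_space unit_cube (\<T> (Suc n))) \<phi>"
  shows "\<exists>\<sigma>. classical_gradient_flow (energy_F unit_cube f (\<delta> n) T \<phi>) \<sigma>0 \<sigma> \<and>
             \<sigma> real_analytic_on {0<..} \<and>
             (\<forall>\<tau>. classical_gradient_flow (energy_F unit_cube f (\<delta> n) T \<phi>) \<sigma>0 \<tau> \<longrightarrow>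
                  (\<forall>t\<ge>0. \<tau> t = \<sigma> t))"
proof -
  have sub: "\<exists>S\<in>\<T> n. S' \<subseteq> S" if "S' \<in> \<T> (Suc n)" for S'
    using assms(5)[of n] that by (auto simp: uniform_refinement_def)
  have ref: "\<Union>{S' \<in> \<T> (Suc n). S' \<subseteq> S} = S" if "S \<in> \<T> n" for S
    using assms(5)[of n] that by (auto simp: uniform_refinement_def)
  have T: "\<T> n = range T" using assms(9) by (simp add: bij_betw_def)
  interpret fe: fe_basis "\<T> (Suc n)" T \<phi>
    using assms(4)[of "Suc n"] sub ref assms(10) by unfold_locales (auto simp: T)
  interpret psd_pencil "\<lambda>i. local_stiffness \<phi> (T i)" "\<delta> n" "load_vector unit_cube f \<phi>" "volume_vector T"
  proof
    show "x \<bullet> (local_stiffness \<phi> (T i) *v y) = y \<bullet> (local_stiffness \<phi> (T i) *v x)" for x y i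
      unfolding fe.local_stiffness_form by (simp only: inner_commute)
    show "0 \<le> x \<bullet> (local_stiffness \<phi> (T i) *v x)" for x i
      unfolding fe.local_stiffness_form by (intro integral_nonneg fe.integrable_form inner_ge_zero)
  qed (use fe.stiffness_kernel assms(7) in auto)
  have "energy_F unit_cube f (\<delta> n) T \<phi> = F"
    by (simp add: fun_eq_iff energy_F_def energy_E_def F_def u_def A_def stiffness_def)
  then show ?thesis using gradient_flow_well_posed[of \<sigma>0] by simp
qed

end
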